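(* Let $G$ be a strongly topological gyrogroup and let $H$ be a locally compact strong subgyrogroup of $G$. For each of the following properties, if the quotient space $G/H$ has the property, then $G$ also has the same property: (1) locally compact; (2) locally countably compact; (3) locally pseudocompact; (4) locally $\sigma$-compact; (5) locally Lindelöf; (6) locally Čech-complete; (7) locally realcompact.
   Context: All topological spaces are assumed Hausdorff. A gyrogroup is a nonempty set $G$ with a binary operation $\oplus$ such that: (G1) there is a unique $0\in G$ with $0\oplus a=a=a\oplus 0$ for all $a$; (G2) each $x\in G$ has a unique inverse $\ominus x$ with $\ominus x\oplus x=0=x\oplus(\ominus x)$; (G3) for all $x,y\in G$ there is an automorphism $\mathrm{gyr}[x,y]$ of $(G,\oplus)$ with $x\oplus(y\oplus z)=(x\oplus y)\oplus\mathrm{gyr}[x,y](z)$ for all $z\in G$; (G4) $\mathrm{gyr}[x\oplus y,y]=\mathrm{gyr}[x,y]$ for all $x,y\in G$. A topological gyrogroup is a gyrogroup with a topology making $\oplus:G\times G\to G$ jointly continuous and $x\mapsto\ominus x$ continuous. It is a strongly topological gyrogroup if there is a neighborhood base $\mathscr U$ of $0$ with $\mathrm{gyr}[x,y](U)=U$ for all $U\in\mathscr U$ and $x,y\in G$. A subgyrogroup is a nonempty subset $H\subseteq G$ that is a gyrogroup under the inherited operation and such that $\mathrm{gyr}[a,b]$ restricts to an automorphism of $H$ for all $a,b\in H$. It is a strong subgyrogroup if $\mathrm{gyr}[x,y](H)=H$ for all $x,y\in G$. For such $H$ the left cosets $a\oplus H$ ($a\in G$) partition $G$; $G/H=\{a\oplus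 H:a\in G\}$ carries the quotient topology induced by $\pi:G\to G/H$, $\pi(a)=a\oplus H$. Subgyrogroups carry the subspace topology. A space is locally $\mathcal Q$, for a property $\mathcal Q$, if every point has an open neighborhood whose closure (as a subspace) has $\mathcal Q$. As usual, pseudocompact, Čech-complete and realcompact spaces are by definition completely regular Hausdorff. *)

theory Defs
  imports "HOL-Analysis.Analysis"
begin

section \<open>Gyrogroups\<close>

definition is_gyro_identity :: "'a set \<Rightarrow> ('a \<Rightarrow> 'a \<Rightarrow> 'a) \<Rightarrow> 'a \<Rightarrow> bool" where
  "is_gyro_identity G op z \<longleftrightarrow> z \<in> G \<and> (\<forall>a\<in>G. op z a = a \<and> op a z = a)"

definition gyro_zero :: "'a set \<Rightarrow> ('a \<Rightarrow> 'a \<Rightarrow> 'a) \<Rightarrow> 'a" where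
  "gyro_zero G op = (THE z. is_gyro_identity G op z)"

definition is_gyro_inverse :: "'a set \<Rightarrow> ('a \<Rightarrow> 'a \<Rightarrow> 'a) \<Rightarrow> 'a \<Rightarrow> 'a \<Rightarrow> bool" where
  "is_gyro_inverse G op x y \<longleftrightarrow>
     y \<in> G \<and> op y x = gyro_zero G op \<and> op x y = gyro_zero G op"

definition gyro_inv :: "'a set \<Rightarrow> ('a \<Rightarrow> 'a \<Rightarrow> 'a) \<Rightarrow> 'a \<Rightarrow> 'a" where
  "gyro_inv G op x = (THE y. is_gyro_inverse G op x y)"

definition gyro_automorphism :: "'a set \<Rightarrow> ('a \<Rightarrow> 'a \<Rightarrow> 'a) \<Rightarrow> ('a \<Rightarrow> 'a) \<Rightarrow> bool" where
  "gyro_automorphism G op f \<longleftrightarrow>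
     bij_betw f G G \<and> (\<forall>a\<in>G. \<forall>b\<in>G. f (op a b) = op (f a) (f b))"

text \<open>The gyrations are carried as a parameter. On \<open>G\<close> they are determined by the
  operation, because left translations are injective; values outside \<open>G\<close> are irrelevant.\<close>

locale gyrogroup =
  fixes G :: "'a set"
    and op :: "'a \<Rightarrow> 'a \<Rightarrow> 'a"
    and gyr :: "'a \<Rightarrow> 'a \<Rightarrow> 'a \<Rightarrow> 'a"
  assumes nonempty: "G \<noteq> {}"
    and closed: "\<lbrakk>x \<in> G; y \<in> G\<rbrakk> \<Longrightarrow> op x y \<in> G"
    and identity: "\<exists>!z. is_gyro_identity G op z"
    and inverse: "x \<in> G \<Longrightarrow> \<exists>!y. is_gyro_inverse G op x y"
    and gyr_automorphism: "\<lbrakk>x \<in> G; y \<in> G\<rbrakk> \<Longrightarrow> gyro_automorphism G op (gyr x y)"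
    and gyr_assoc: "\<lbrakk>x \<in> G; y \<in> G; z \<in> G\<rbrakk> \<Longrightarrow> op x (op y z) = op (op x y) (gyr x y z)"
    and gyr_loop: "\<lbrakk>x \<in> G; y \<in> G; z \<in> G\<rbrakk> \<Longrightarrow> gyr (op x y) y z = gyr x y z"

definition subgyrogroup ::
    "'a set \<Rightarrow> ('a \<Rightarrow> 'a \<Rightarrow> 'a) \<Rightarrow> ('a \<Rightarrow> 'a \<Rightarrow> 'a \<Rightarrow> 'a) \<Rightarrow> 'a set \<Rightarrow> bool" where
  "subgyrogroup G op gyr H \<longleftrightarrow>
     H \<noteq> {} \<and> H \<subseteq> G \<and> (\<exists>gyr'. gyrogroup H op gyr') \<and>
     (\<forall>a\<in>H. \<forall>b\<in>H. gyro_automorphism H op (gyr a b))"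

definition strong_subgyrogroup ::
    "'a set \<Rightarrow> ('a \<Rightarrow> 'a \<Rightarrow> 'a) \<Rightarrow> ('a \<Rightarrow> 'a \<Rightarrow> 'a \<Rightarrow> 'a) \<Rightarrow> 'a set \<Rightarrow> bool" where
  "strong_subgyrogroup G op gyr H \<longleftrightarrow>
     subgyrogroup G op gyr H \<and> (\<forall>x\<in>G. \<forall>y\<in>G. gyr x y ` H = H)"


section \<open>Topological gyrogroups\<close>

text \<open>The underlying gyrogroup lives on \<open>topspace T\<close>.\<close>

locale topological_gyrogroup = gyrogroup "topspace T" op gyr
  for T :: "'a topology" and op gyr +
  assumes Hausdorff: "Hausdorff_space T"
    and continuous_op: "continuous_map (prod_topology T T) T (\<lambda>(x, y). op x y)"
    and continuous_inv: "continuous_map T T (gyro_inv (topspace T) op)"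

text \<open>As usual, the members of a neighbourhood base need not be open.\<close>

definition neighbourhood_base_family :: "'a topology \<Rightarrow> 'a \<Rightarrow> 'a set set \<Rightarrow> bool" where
  "neighbourhood_base_family T p \<U> \<longleftrightarrow>
     (\<forall>U\<in>\<U>. U \<subseteq> topspace T \<and> (\<exists>V. openin T V \<and> p \<in> V \<and> V \<subseteq> U)) \<and>
     (\<forall>W. openin T W \<and> p \<in> W \<longrightarrow> (\<exists>U\<in>\<U>. U \<subseteq> W))"

locale strongly_topological_gyrogroup = topological_gyrogroup T op gyr
  for T :: "'a topology" and op gyr +
  assumes gyr_invariant_base:
    "\<exists>\<U>. neighbourhood_base_family T (gyro_zero (topspace T) op) \<U> \<and>
         (\<forall>U\<in>\<U>. \<forall>x\<in>topspace T. \<forall>y\<in>topspace T. gyr x y ` U = U)"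


section \<open>Quotient spaces\<close>

definition quotient_topology :: "'a topology \<Rightarrow> ('a \<Rightarrow> 'b) \<Rightarrow> 'b topology" where
  "quotient_topology X p =
     topology (\<lambda>U. U \<subseteq> p ` topspace X \<and> openin X {x \<in> topspace X. p x \<in> U})"

lemma openin_quotient_topology:
  "openin (quotient_topology X p) U \<longleftrightarrow>
     U \<subseteq> p ` topspace X \<and> openin X {x \<in> topspace X. p x \<in> U}"
proof -
  have "istopology (\<lambda>U. U \<subseteq> p ` topspace X \<and> openin X {x \<in> topspace X. p x \<in> U})"
    unfolding istopology_def
  proof (intro conjI allI impI)
    fix S T
    assume S: "S \<subseteq> p ` topspace X \<and> openin X {x \<in> topspace X. p x \<in> S}"
      and T: "T \<subseteq> p ` topspace X \<and> openin X {x \<in> topspace X. p x \<in> T}"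
    have "{x \<in> topspace X. p x \<in> S \<inter> T} =
          {x \<in> topspace X. p x \<in> S} \<inter> {x \<in> topspace X. p x \<in> T}"
      by blast
    then show "openin X {x \<in> topspace X. p x \<in> S \<inter> T}"
      using S T by (simp add: openin_Int)
    show "S \<inter> T \<subseteq> p ` topspace X" using S by blast
  next
    fix \<K>
    assume K: "\<forall>K\<in>\<K>. K \<subseteq> p ` topspace X \<and> openin X {x \<in> topspace X. p x \<in> K}"
    have "{x \<in> topspace X. p x \<in> \<Union>\<K>} = (\<Union>K\<in>\<K>. {x \<in> topspace X. p x \<in> K})"
      by blast
    then show "openin X {x \<in> topspace X. p x \<in> \<Union>\<K>}"
      using K by auto
    show "\<Union>\<K> \<subseteq> p ` topspace X" using K by blast
  qed
  then show ?thesis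
    by (simp add: quotient_topology_def topology_inverse')
qed

lemma topspace_quotient_topology [simp]:
  "topspace (quotient_topology X p) = p ` topspace X"
proof
  show "topspace (quotient_topology X p) \<subseteq> p ` topspace X"
    using openin_topspace[of "quotient_topology X p"]
    unfolding openin_quotient_topology by (rule conjunct1)
  have "{x \<in> topspace X. p x \<in> p ` topspace X} = topspace X" by blast
  then show "p ` topspace X \<subseteq> topspace (quotient_topology X p)"
    by (intro openin_subset) (simp add: openin_quotient_topology)
qed

lemma quotient_map_quotient_topology: "quotient_map X (quotient_topology X p) p"
  by (simp add: quotient_map_def openin_quotient_topology)

definition gyro_coset :: "('a \<Rightarrow> 'a \<Rightarrow> 'a) \<Rightarrow> 'a set \<Rightarrow> 'a \<Rightarrow> 'a set" where
  "gyro_coset op H a = op a ` H"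

definition gyro_quotient :: "'a topology \<Rightarrow> ('a \<Rightarrow> 'a \<Rightarrow> 'a) \<Rightarrow> 'a set \<Rightarrow> 'a set topology" where
  "gyro_quotient T op H = quotient_topology T (gyro_coset op H)"


section \<open>Topological properties\<close>

definition locally_has :: "('a topology \<Rightarrow> bool) \<Rightarrow> 'a topology \<Rightarrow> bool" where
  "locally_has Q X \<longleftrightarrow>
     (\<forall>x\<in>topspace X. \<exists>U. openin X U \<and> x \<in> U \<and> Q (subtopology X (X closure_of U)))"

lemma locally_has_compact_iff:
  assumes "Hausdorff_space X"
  shows "locally_has compact_space X \<longleftrightarrow> locally_compact_space X"
proof -
  have "compact_space (subtopology X (X closure_of U)) \<longleftrightarrow> compactin X (X closure_of U)" for U
    by (simp add: compactin_subspace closure_of_subset_topspace)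
  then have 1: "locally_has compact_space X \<longleftrightarrow>
      (\<forall>x\<in>topspace X. \<exists>U. openin X U \<and> x \<in> U \<and> compactin X (X closure_of U))"
    by (simp add: locally_has_def)
  have "Hausdorff_space X \<or> regular_space X"
    using assms by simp
  from locally_compact_space_compact_closure_of[OF this] show ?thesis
    unfolding 1 by (simp only: conj_commute conj_left_commute)
qed

definition countably_compact_space :: "'a topology \<Rightarrow> bool" where
  "countably_compact_space X \<longleftrightarrow>
     (\<forall>\<U>. countable \<U> \<and> (\<forall>U\<in>\<U>. openin X U) \<and> \<Union>\<U> = topspace X
        \<longrightarrow> (\<exists>\<V>. finite \<V> \<and> \<V> \<subseteq> \<U> \<and> \<Union>\<V> = topspace X))"

definition sigma_compact_space :: "'a topology \<Rightarrow> bool" where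
  "sigma_compact_space X \<longleftrightarrow>
     (\<exists>\<K>. countable \<K> \<and> (\<forall>K\<in>\<K>. compactin X K) \<and> \<Union>\<K> = topspace X)"

definition Tychonoff_space :: "'a topology \<Rightarrow> bool" where
  "Tychonoff_space X \<longleftrightarrow> completely_regular_space X \<and> Hausdorff_space X"

definition pseudocompact_space :: "'a topology \<Rightarrow> bool" where
  "pseudocompact_space X \<longleftrightarrow>
     Tychonoff_space X \<and>
     (\<forall>f. continuous_map X euclideanreal f \<longrightarrow> bounded (f ` topspace X))"

text \<open>The Stone-Cech compactification of \<open>X\<close> is the closure of the image of \<open>X\<close> under
  evaluation in the cube \<open>[0,1]\<^sup>I\<close>, where \<open>I\<close> is the set of continuous maps from \<open>X\<close>
  to \<open>[0,1]\<close>. These are taken to be extensional so that each map on \<open>topspace X\<close> occurs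
  once.\<close>

definition stone_cech_index :: "'a topology \<Rightarrow> ('a \<Rightarrow> real) set" where
  "stone_cech_index X =
     {f \<in> extensional (topspace X). continuous_map X (top_of_set {0..1}) f}"

definition stone_cech_embedding :: "'a topology \<Rightarrow> 'a \<Rightarrow> ('a \<Rightarrow> real) \<Rightarrow> real" where
  "stone_cech_embedding X x = (\<lambda>f\<in>stone_cech_index X. f x)"

definition stone_cech_cube :: "'a topology \<Rightarrow> (('a \<Rightarrow> real) \<Rightarrow> real) topology" where
  "stone_cech_cube X = product_topology (\<lambda>_. top_of_set {0..1}) (stone_cech_index X)"

definition stone_cech :: "'a topology \<Rightarrow> (('a \<Rightarrow> real) \<Rightarrow> real) topology" where
  "stone_cech X =
     subtopology (stone_cech_cube X)
       (stone_cech_cube X closure_of (stone_cech_embedding X ` topspace X))"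

definition Cech_complete_space :: "'a topology \<Rightarrow> bool" where
  "Cech_complete_space X \<longleftrightarrow>
     Tychonoff_space X \<and> gdelta_in (stone_cech X) (stone_cech_embedding X ` topspace X)"

text \<open>A space is realcompact if it is homeomorphic to a closed subspace of a power of the
  real line. Restricting the exponent to subsets of \<open>'a \<Rightarrow> real\<close> loses nothing: given any
  closed embedding into a power, coordinates inducing the same function on \<open>X\<close> can be
  merged, after which they are indexed by real functions on \<open>X\<close>.\<close>

definition realcompact_space :: "'a topology \<Rightarrow> bool" where
  "realcompact_space X \<longleftrightarrow>
     Tychonoff_space X \<and>
     (\<exists>(I :: ('a \<Rightarrow> real) set) S.
        closedin (powertop_real I) S \<and> X homeomorphic_space subtopology (powertop_real I) S)"

end

theory Submission
  imports Defs
begin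

text \<open>Near \<open>0\<close> the coset map \<open>\<pi>\<close> is proper: if \<open>F\<close> is a closed and sufficiently small neighbourhood of \<open>0\<close>,
  then \<open>F\<close> meets each coset in a closed subset of a left translate of a compact subset of \<open>H\<close>, and
  \<open>\<pi>\<close> maps closed subsets of \<open>F\<close> to closed sets. Left translations carry this to every point of
  \<open>G\<close>, and preimages of spaces with the given property under continuous proper maps of Tychonoff
  spaces, not necessarily onto, have the property again. The exception is pseudocompactness, which
  needs in addition that \<open>\<pi>\<close> is open: an unbounded continuous function on the closure of an open
  set \<open>U\<close> would yield a locally finite sequence of nonempty open subsets \<open>\<pi>({x \<in> U. n < \<bar>f x\<bar>})\<close>.
  The gyration-invariant base at \<open>0\<close> enters through the complete regularity of \<open>G\<close>.\<close>

section \<open>Left translations, right division and cosets\<close>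

context gyrogroup
begin

abbreviation zero :: 'a where "zero \<equiv> gyro_zero G op"
abbreviation inv :: "'a \<Rightarrow> 'a" where "inv \<equiv> gyro_inv G op"

lemma is_gyro_identity_zero: "is_gyro_identity G op zero"
  unfolding gyro_zero_def by (rule theI'[OF identity])

lemma zero_closed [simp]: "zero \<in> G"
  and zero_left [simp]: "x \<in> G \<Longrightarrow> op zero x = x"
  and zero_right [simp]: "x \<in> G \<Longrightarrow> op x zero = x"
  using is_gyro_identity_zero by (auto simp: is_gyro_identity_def)

lemma is_gyro_inverse_inv: "x \<in> G \<Longrightarrow> is_gyro_inverse G op x (inv x)"
  unfolding gyro_inv_def by (rule theI'[OF inverse])

lemma inv_closed [simp]: "x \<in> G \<Longrightarrow> inv x \<in> G"
  and inv_left [simp]: "x \<in> G \<Longrightarrow> op (inv x) x = zero"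
  and inv_right [simp]: "x \<in> G \<Longrightarrow> op x (inv x) = zero"
  using is_gyro_inverse_inv by (auto simp: is_gyro_inverse_def)

lemma inv_inv [simp]:
  assumes "x \<in> G"
  shows "inv (inv x) = x"
proof -
  have "is_gyro_inverse G op (inv x) x"
    using assms by (simp add: is_gyro_inverse_def)
  then show ?thesis
    using is_gyro_inverse_inv[of "inv x"] inverse[of "inv x"] assms by auto
qed

lemma inv_zero [simp]: "inv zero = zero"
  using zero_right[of "inv zero"] inv_left[of zero] by simp

lemma gyr_bij: "\<lbrakk>x \<in> G; y \<in> G\<rbrakk> \<Longrightarrow> bij_betw (gyr x y) G G"
  using gyr_automorphism by (simp add: gyro_automorphism_def)

lemma gyr_closed [simp]: "\<lbrakk>x \<in> G; y \<in> G; z \<in> G\<rbrakk> \<Longrightarrow> gyr x y z \<in> G"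
  using gyr_bij bij_betwE by blast

text \<open>Translating both products by \<open>inv a\<close> returns \<open>b\<close> and
  \<open>c\<close> only up to the gyration \<open>gyr (inv a) a\<close>, which is injective.\<close>

lemma left_cancel:
  assumes "a \<in> G" "b \<in> G" "c \<in> G" "op a b = op a c"
  shows "b = c"
proof -
  have "gyr (inv a) a b = gyr (inv a) a c"
    using gyr_assoc[of "inv a" a b] gyr_assoc[of "inv a" a c] assms by simp
  then show ?thesis
    using gyr_bij[of "inv a" a] assms unfolding bij_betw_def by (metis inj_onD inv_closed)
qed

lemma gyr_zero_left: "\<lbrakk>a \<in> G; b \<in> G\<rbrakk> \<Longrightarrow> gyr zero a b = b"
  using gyr_assoc[of zero a b] left_cancel[of a b "gyr zero a b"] closed by simp

text \<open>The loop property turns \<open>gyr (inv a) a\<close> into \<open>gyr zero a\<close>,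
  which acts as the identity.\<close>

lemma left_inv [simp]: "\<lbrakk>a \<in> G; b \<in> G\<rbrakk> \<Longrightarrow> op (inv a) (op a b) = b"
  using gyr_loop[of "inv a" a b] gyr_assoc[of "inv a" a b] gyr_zero_left[of a b] closed by simp

lemma right_inv [simp]: "\<lbrakk>a \<in> G; b \<in> G\<rbrakk> \<Longrightarrow> op a (op (inv a) b) = b"
  using left_inv[of "inv a" b] by simp

text \<open>In terms of left translations, the loop property of the gyrations is the left Bol identity.\<close>

lemma left_Bol:
  assumes G: "a \<in> G" "b \<in> G" "z \<in> G"
  shows "op b (op a (op b z)) = op (op b (op a b)) z"
proof -
  \<comment> \<open>With this \<open>y\<close> the product \<open>op (inv a) y\<close> is
    \<open>b\<close>, so the loop property identifies \<open>gyr b y\<close> with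
    \<open>gyr (inv a) y\<close>; \<open>t\<close> is the element that this gyration sends to
    \<open>z\<close>.\<close>
  define y where "y = op a b"
  define t where "t = op (inv y) (op a (op b z))"
  have y: "y \<in> G" and t: "t \<in> G"
    using G closed by (auto simp: y_def t_def)
  have xy: "op (inv a) y = b"
    using G by (simp add: y_def)
  have yt: "op y t = op a (op b z)"
    using G y closed by (simp add: t_def)
  have "op b (gyr (inv a) y t) = op b z"
    using gyr_assoc[of "inv a" y t] G y t xy yt closed by simp
  then have "gyr (inv a) y t = z"
    using left_cancel G y t by (meson gyr_closed inv_closed)
  moreover have "gyr b y t = gyr (inv a) y t"
    using gyr_loop[of "inv a" y t] G y t xy by simp
  ultimately show ?thesis
    using gyr_assoc[of b y t] G y t yt by (simp add: y_def)
qed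

text \<open>The solution \<open>u\<close> of \<open>op u a = y\<close>, found by the left Bol
  identity. The formula is continuous in \<open>y\<close> in a topological gyrogroup, so right
  translations will be homeomorphisms.\<close>

definition right_div :: "'a \<Rightarrow> 'a \<Rightarrow> 'a" where
  "right_div y a = op (inv a) (op (op a y) (inv a))"

lemma right_div_closed [simp]: "\<lbrakk>a \<in> G; y \<in> G\<rbrakk> \<Longrightarrow> right_div y a \<in> G"
  by (simp add: right_div_def closed)

lemma op_right_div: "\<lbrakk>a \<in> G; y \<in> G\<rbrakk> \<Longrightarrow> op (right_div y a) a = y"
  using left_Bol[of "op a y" "inv a" a] by (simp add: right_div_def closed)

lemma right_div_op: "\<lbrakk>a \<in> G; u \<in> G\<rbrakk> \<Longrightarrow> right_div (op u a) a = u"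
  using left_Bol[of u a "inv a"] by (simp add: right_div_def closed flip: left_Bol)

end

section \<open>Cosets of a strong subgyrogroup\<close>

locale gyrogroup_strong_sub = gyrogroup G op gyr
  for G :: "'a set" and op gyr +
  fixes H :: "'a set"
  assumes strong: "strong_subgyrogroup G op gyr H"
begin

lemma H_subset: "H \<subseteq> G"
  and gyr_H: "\<lbrakk>x \<in> G; y \<in> G\<rbrakk> \<Longrightarrow> gyr x y ` H = H"
  using strong by (auto simp: strong_subgyrogroup_def subgyrogroup_def)

lemma H_in_G [simp]: "h \<in> H \<Longrightarrow> h \<in> G"
  using H_subset by blast

lemma H_closed: "\<lbrakk>h \<in> H; k \<in> H\<rbrakk> \<Longrightarrow> op h k \<in> H"
  using strong gyrogroup.closed unfolding strong_subgyrogroup_def subgyrogroup_def by fastforce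

text \<open>As a gyrogroup \<open>H\<close> has an identity and inverses of its own; left
  cancellation in \<open>G\<close> identifies them with those of \<open>G\<close>.\<close>

lemma H_zero: "zero \<in> H"
  and H_inv: "h \<in> H \<Longrightarrow> inv h \<in> H"
proof -
  obtain gyr' where "gyrogroup H op gyr'"
    using strong by (auto simp: strong_subgyrogroup_def subgyrogroup_def)
  then interpret S: gyrogroup H op gyr' .
  have "op S.zero S.zero = op S.zero zero"
    using S.zero_closed by simp
  then have eq: "S.zero = zero"
    using left_cancel by (meson H_in_G S.zero_closed zero_closed)
  then show "zero \<in> H"
    using S.zero_closed by simp
  assume h: "h \<in> H"
  then have "op h (S.inv h) = op h (inv h)"
    using eq by simp
  then have "S.inv h = inv h"
    using left_cancel h by (meson H_in_G S.inv_closed inv_closed)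
  then show "inv h \<in> H"
    using S.inv_closed h by metis
qed

abbreviation coset :: "'a \<Rightarrow> 'a set" where "coset \<equiv> gyro_coset op H"

lemma coset_iff: "y \<in> coset x \<longleftrightarrow> (\<exists>h\<in>H. y = op x h)"
  by (auto simp: gyro_coset_def)

lemma self_in_coset: "x \<in> G \<Longrightarrow> x \<in> coset x"
  using H_zero by (force simp: coset_iff)

text \<open>Gyrations map \<open>H\<close> onto itself, so in \<open>op (op x h) k\<close> one may
  write \<open>k = gyr x h k'\<close> and reassociate to \<open>op x (op h k')\<close>. Hence the
  cosets partition \<open>G\<close>.\<close>

lemma coset_op:
  assumes "x \<in> G" "h \<in> H"
  shows "coset (op x h) = coset x"
proof
  show "coset (op x h) \<subseteq> coset x"
  proof
    fix y assume "y \<in> coset (op x h)"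
    then obtain k where k: "k \<in> H" "y = op (op x h) k"
      by (auto simp: coset_iff)
    then obtain k' where "k' \<in> H" "k = gyr x h k'"
      using gyr_H[of x h] assms by auto
    then have "y = op x (op h k')"
      using gyr_assoc[of x h k'] assms k by simp
    then show "y \<in> coset x"
      using \<open>k' \<in> H\<close> assms H_closed by (auto simp: coset_iff)
  qed
  show "coset x \<subseteq> coset (op x h)"
  proof
    fix y assume "y \<in> coset x"
    then obtain k where k: "k \<in> H" "y = op x k"
      by (auto simp: coset_iff)
    define k' where "k' = op (inv h) k"
    have k': "k' \<in> H" "op h k' = k"
      using assms k H_closed H_inv by (auto simp: k'_def)
    then show "y \<in> coset (op x h)"
      using gyr_assoc[of x h k'] assms k gyr_H[of x h] by (auto simp: coset_iff)
  qed
qed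

lemma coset_eq_iff: "\<lbrakk>x \<in> G; y \<in> G\<rbrakk> \<Longrightarrow> coset x = coset y \<longleftrightarrow> (\<exists>h\<in>H. y = op x h)"
  using coset_op self_in_coset coset_iff by metis

lemma coset_translate:
  assumes "a \<in> G" "x \<in> G" "h \<in> H"
  obtains k where "k \<in> H" "op (op a x) h = op a (op x k)"
proof -
  obtain k where "k \<in> H" "h = gyr a x k"
    using gyr_H[of a x] assms by auto
  then show thesis
    using gyr_assoc[of a x k] assms that by simp
qed

end

section \<open>Complete regularity\<close>

text \<open>The idea is to apply the dyadic construction from the proof of Urysohn's lemma to an
  interpolating proximity relation \<open>R\<close> instead of to the open sets of a normal space.\<close>

lemma dyadic_between:
  fixes a b :: real
  assumes "0 \<le> a" "a < b" "b \<le> 1"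
  obtains r where "r \<in> dyadics \<inter> {0..1}" "a < r" "r < b"
proof -
  have pos: "0 < (a + b) / 2" "0 < (b - a) / 2"
    using assms by auto
  \<comment> \<open>The two fractions straddle the midpoint at distance less than
    \<open>(b - a) / 2\<close>, so both lie strictly between \<open>a\<close> and
    \<open>b\<close>.\<close>
  obtain n q r where *: "of_nat q / 2^n < (a + b) / 2" "(a + b) / 2 < of_nat r / 2^n"
      "\<bar>q / 2^n - r / 2^n \<bar> < (b - a) / 2"
    by (rule padic_rational_approximation_straddle_pos[of "(b - a) / 2" 2 "(a + b) / 2"])
       (use pos in auto)
  have mid: "a < v \<and> v < b" if "u < (a + b) / 2" "(a + b) / 2 < v" "\<bar>u - v\<bar> < (b - a) / 2" for u v
    using that by (simp add: abs_if split: if_splits)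
  show thesis
  proof
    show ab: "a < real r / 2 ^ n" "real r / 2 ^ n < b"
      using * mid by blast+
    then have "real r / 2 ^ n \<le> 1"
      using assms(3) by linarith
    then show "real r / 2 ^ n \<in> dyadics \<inter> {0..1}"
      by (auto simp: dyadics_def)
  qed
qed

lemma separating_function:
  fixes X :: "'a topology" and R :: "'a set \<Rightarrow> 'a set \<Rightarrow> bool"
  assumes base: "R A B"
    and interpolate: "\<And>C D. R C D \<Longrightarrow> \<exists>M. R C M \<and> R M D"
    and trans: "\<And>C D E. \<lbrakk>R C D; R D E\<rbrakk> \<Longrightarrow> R C E"
    and strong: "\<And>C D. R C D \<Longrightarrow> X closure_of C \<subseteq> X interior_of D"
    and sub: "\<And>C D. R C D \<Longrightarrow> C \<subseteq> topspace X"
  obtains f :: "'a \<Rightarrow> real" where "continuous_map X (top_of_set {0..1}) f"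
    "f ` A \<subseteq> {0}" "f ` (topspace X - B) \<subseteq> {1}"
proof -
  have "\<exists>S :: real \<Rightarrow> 'a set. S 0 = A \<and> S 1 = B \<and>
      (\<forall>x \<in> dyadics \<inter> {0..1}. \<forall>y \<in> dyadics \<inter> {0..1}. x < y \<longrightarrow> R (S x) (S y))"
    by (rule recursion_on_dyadic_fractions) (fact base interpolate trans)+
  then obtain S :: "real \<Rightarrow> 'a set" where S0: "S 0 = A" and S1: "S 1 = B"
    and S: "\<And>x y. \<lbrakk>x \<in> dyadics \<inter> {0..1}; y \<in> dyadics \<inter> {0..1}; x < y\<rbrakk> \<Longrightarrow> R (S x) (S y)"
    by blast
  have S_interior: "S x \<subseteq> X interior_of (S y)"
    if "x \<in> dyadics \<inter> {0..1}" "y \<in> dyadics \<inter> {0..1}" "x < y" for x y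
    using closure_of_subset[OF sub[OF S[OF that]]] strong[OF S[OF that]] by (rule subset_trans)
  have mono: "S x \<subseteq> S y" if "x \<in> dyadics \<inter> {0..1}" "y \<in> dyadics \<inter> {0..1}" "x < y" for x y
    using S_interior[OF that] interior_of_subset by (rule subset_trans)
  have 01: "0 \<in> dyadics \<inter> {0..1::real}" "1 \<in> dyadics \<inter> {0..1::real}"
    by (force simp: dyadics_def)+
  \<comment> \<open>The inserted \<open>1\<close> keeps the set nonempty and serves as the value at
    points that lie in no \<open>S r\<close>.\<close>
  define f where "f \<equiv> \<lambda>x. Inf (insert 1 {r. r \<in> dyadics \<inter> {0..1} \<and> x \<in> S r})"
  have bdd: "bdd_below (insert 1 {r. r \<in> dyadics \<inter> {0..1} \<and> x \<in> S r})" for x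
    by (rule bdd_belowI[of _ 0]) auto
  have f_ge: "0 \<le> f x" and f_le: "f x \<le> 1" for x
    unfolding f_def by (force intro: cInf_greatest) (rule cInf_lower[OF _ bdd], simp)
  have f_less: "f x < c \<longleftrightarrow> 1 < c \<or> (\<exists>r \<in> dyadics \<inter> {0..1}. x \<in> S r \<and> r < c)" for x c
    unfolding f_def by (subst cInf_less_iff[OF _ bdd]) auto
  have open_less: "openin X {x \<in> topspace X. f x < c}" for c
  proof (subst openin_subopen, intro ballI)
    fix x assume "x \<in> {x \<in> topspace X. f x < c}"
    then have x: "x \<in> topspace X" "f x < c" by auto
    show "\<exists>V. openin X V \<and> x \<in> V \<and> V \<subseteq> {x \<in> topspace X. f x < c}"
    proof (cases "1 < c")
      case True
      then have "{x \<in> topspace X. f x < c} = topspace X"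
        using order.strict_trans1[OF f_le True] by blast
      then show ?thesis using x by auto
    next
      case False
      then obtain r where r: "r \<in> dyadics \<inter> {0..1}" "x \<in> S r" "r < c"
        using f_less x by blast
      then obtain r' where r': "r' \<in> dyadics \<inter> {0..1}" "r < r'" "r' < c"
        using dyadic_between[of r c] False by auto
      have "x \<in> X interior_of (S r')"
        using S_interior[OF r(1) r'(1,2)] r(2) by blast
      moreover have "X interior_of (S r') \<subseteq> {x \<in> topspace X. f x < c}"
        using r' subsetD[OF interior_of_subset[of X "S r'"]]
          subsetD[OF interior_of_subset_topspace[of X "S r'"]] by (auto simp: f_less)
      ultimately show ?thesis
        using openin_interior_of by blast
    qed
  qed
  have open_greater: "openin X {x \<in> topspace X. c < f x}" for c
  proof (subst openin_subopen, intro ballI)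
    fix x assume "x \<in> {x \<in> topspace X. c < f x}"
    then have x: "x \<in> topspace X" "c < f x" by auto
    show "\<exists>V. openin X V \<and> x \<in> V \<and> V \<subseteq> {x \<in> topspace X. c < f x}"
    proof (cases "c < 0")
      case True
      then have "{x \<in> topspace X. c < f x} = topspace X"
        using order.strict_trans2[OF True f_ge] by blast
      then show ?thesis using x by auto
    next
      case False
      \<comment> \<open>Since \<open>r' < f x\<close>, the point \<open>x\<close> is outside
        \<open>S r'\<close> and hence outside the closure of the smaller \<open>S r\<close>. Off
        that closure \<open>f\<close> is at least \<open>r\<close>, which exceeds
        \<open>c\<close>.\<close>
      obtain r' where r': "r' \<in> dyadics \<inter> {0..1}" "c < r'" "r' < f x"
        using dyadic_between[of c "f x"] False x f_le by auto
      obtain r where r: "r \<in> dyadics \<inter> {0..1}" "c < r" "r < r'"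
        using dyadic_between[of c r'] False r' by auto
      have "x \<notin> S r'"
        using f_less[of x "f x"] r' by auto
      then have "x \<in> topspace X - X closure_of (S r)"
        using strong[OF S[OF r(1) r'(1) r(3)]] interior_of_subset[of X "S r'"] x by blast
      moreover have "c < f y" if "y \<in> topspace X - X closure_of (S r)" for y
      proof (rule ccontr)
        assume "\<not> c < f y"
        then have "f y < r" using r by auto
        then obtain s where s: "s \<in> dyadics \<inter> {0..1}" "y \<in> S s" "s < r"
          using f_less r by force
        then have "y \<in> S r" using mono r by blast
        then show False
          using that closure_of_subset_Int by fastforce
      qed
      ultimately show ?thesis
        by (intro exI[of _ "topspace X - X closure_of (S r)"]) auto
    qed
  qed
  show thesis
  proof
    show "continuous_map X (top_of_set {0..1}) f"
      using open_less open_greater f_ge f_le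
      by (auto simp: continuous_map_in_subtopology continuous_map_upper_lower_semicontinuous_lt)
    have "f x \<le> 0" if "x \<in> A" for x
      unfolding f_def by (rule cInf_lower[OF _ bdd]) (use that S0 01 in auto)
    then show "f ` A \<subseteq> {0}"
      using antisym[OF _ f_ge] by blast
    have "\<not> f x < 1" if "x \<in> topspace X - B" for x
    proof
      assume "f x < 1"
      then obtain r where "r \<in> dyadics \<inter> {0..1}" "x \<in> S r" "r < 1"
        using f_less by auto
      then show False
        using mono[of r 1] 01 S1 that by auto
    qed
    then show "f ` (topspace X - B) \<subseteq> {1}"
      using antisym[OF f_le] by (auto simp: not_less)
  qed
qed

lemma continuous_map_prod_nhds:
  assumes f: "continuous_map (prod_topology X Y) Z (\<lambda>(x, y). f x y)" and V: "openin Z V"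
    and x: "x \<in> topspace X" and y: "y \<in> topspace Y" and "f x y \<in> V"
  obtains A B where "openin X A" "openin Y B" "x \<in> A" "y \<in> B"
    "\<And>u v. \<lbrakk>u \<in> A; v \<in> B\<rbrakk> \<Longrightarrow> f u v \<in> V"
proof -
  let ?P = "{z \<in> topspace (prod_topology X Y). (\<lambda>(x, y). f x y) z \<in> V}"
  have "openin (prod_topology X Y) ?P"
    by (rule openin_continuous_map_preimage[OF f V])
  moreover have "(x, y) \<in> ?P"
    using assms by simp
  ultimately obtain A B where "openin X A" "openin Y B" "x \<in> A" "y \<in> B" and AB: "A \<times> B \<subseteq> ?P"
    unfolding openin_prod_topology_alt by meson
  moreover have "f u v \<in> V" if "u \<in> A" "v \<in> B" for u v
    using subsetD[OF AB, of "(u, v)"] that by simp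
  ultimately show thesis
    using that by blast
qed

section \<open>Translations as homeomorphisms\<close>

context topological_gyrogroup
begin

lemma continuous_map_op [continuous_intros]:
  assumes "continuous_map X T f" "continuous_map X T g"
  shows "continuous_map X T (\<lambda>x. op (f x) (g x))"
proof -
  have "continuous_map X (prod_topology T T) (\<lambda>x. (f x, g x))"
    using assms by (simp add: continuous_map_pairedI)
  from continuous_map_compose[OF this continuous_op] show ?thesis
    by (simp add: o_def)
qed

lemma continuous_map_inv [continuous_intros]:
  "continuous_map X T f \<Longrightarrow> continuous_map X T (\<lambda>x. inv (f x))"
  using continuous_map_compose[OF _ continuous_inv] by (simp add: o_def)

lemma homeomorphic_map_left_translation:
  assumes "a \<in> topspace T"
  shows "homeomorphic_map T T (op a)"
proof -
  have "homeomorphic_maps T T (op a) (op (inv a))"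
    using assms unfolding homeomorphic_maps_def
    by (auto intro!: continuous_intros simp: closed)
  then show ?thesis
    using homeomorphic_map_maps by blast
qed

lemma openin_left_translation: "\<lbrakk>a \<in> topspace T; openin T V\<rbrakk> \<Longrightarrow> openin T (op a ` V)"
  using homeomorphic_map_left_translation homeomorphic_map_openness_eq by blast

lemma homeomorphic_map_right_translation:
  assumes "a \<in> topspace T"
  shows "homeomorphic_map T T (\<lambda>x. op x a)"
proof -
  have "homeomorphic_maps T T (\<lambda>x. op x a) (\<lambda>y. right_div y a)"
    using assms unfolding homeomorphic_maps_def
    by (auto intro!: continuous_intros simp: closed op_right_div right_div_op)
       (auto intro!: continuous_intros simp: closed right_div_def)
  then show ?thesis
    using homeomorphic_map_maps by blast
qed

end

section \<open>Gyration-invariant neighbourhoods of the identity\<close>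

context strongly_topological_gyrogroup
begin

definition invariant_nbhd :: "'a set \<Rightarrow> bool" where
  "invariant_nbhd U \<longleftrightarrow> U \<subseteq> topspace T \<and> (\<exists>V. openin T V \<and> zero \<in> V \<and> V \<subseteq> U) \<and>
    (\<forall>x\<in>topspace T. \<forall>y\<in>topspace T. gyr x y ` U = U)"

lemma invariant_nbhd_within:
  assumes "openin T W" "zero \<in> W"
  obtains U where "invariant_nbhd U" "U \<subseteq> W"
  using gyr_invariant_base assms unfolding neighbourhood_base_family_def invariant_nbhd_def
  by metis

text \<open>The relation \<open>R\<close> to which \<open>separating_function\<close> is applied.
  One neighbourhood \<open>U\<close> fattens all of \<open>A\<close>, and its invariance allows the
  fattening to be iterated and reversed despite the gyrations.\<close>

definition strongly_within :: "'a set \<Rightarrow> 'a set \<Rightarrow> bool" where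
  "strongly_within A B \<longleftrightarrow> A \<subseteq> topspace T \<and>
    (\<exists>U. invariant_nbhd U \<and> (\<forall>a\<in>A. \<forall>u\<in>U. op a u \<in> B))"

text \<open>Take an invariant \<open>U'\<close> whose pairwise products lie in \<open>U\<close>, and
  fatten \<open>A\<close> by \<open>U'\<close> to get \<open>M\<close>. Fattening twice stays in
  \<open>B\<close> because \<open>op (op a u) v = op a (op u w)\<close> for
  \<open>v = gyr a u w\<close>, and invariance puts \<open>w\<close> in \<open>U'\<close>.\<close>

lemma strongly_within_interpolate:
  assumes "strongly_within A B"
  shows "\<exists>M. strongly_within A M \<and> strongly_within M B"
proof -
  obtain U where A: "A \<subseteq> topspace T" and U: "invariant_nbhd U" "\<forall>a\<in>A. \<forall>u\<in>U. op a u \<in> B"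
    using assms by (auto simp: strongly_within_def)
  obtain V where V: "openin T V" "zero \<in> V" "V \<subseteq> U"
    using U by (auto simp: invariant_nbhd_def)
  obtain W1 W2 where W: "openin T W1" "openin T W2" "zero \<in> W1" "zero \<in> W2"
      "\<And>u v. \<lbrakk>u \<in> W1; v \<in> W2\<rbrakk> \<Longrightarrow> op u v \<in> V"
    using continuous_map_prod_nhds[OF continuous_op V(1), of zero zero] V(2) by auto
  obtain U' where U': "invariant_nbhd U'" "U' \<subseteq> W1 \<inter> W2"
    using invariant_nbhd_within[of "W1 \<inter> W2"] W by auto
  have U'_G: "U' \<subseteq> topspace T"
    using U' by (simp add: invariant_nbhd_def)
  have UU: "op u v \<in> U" if "u \<in> U'" "v \<in> U'" for u v
    using W(5)[of u v] that U'(2) V(3) by blast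
  define M where "M = {op a u |a u. a \<in> A \<and> u \<in> U'}"
  have "op (op a u) v \<in> B" if "a \<in> A" "u \<in> U'" "v \<in> U'" for a u v
  proof -
    have au: "a \<in> topspace T" "u \<in> topspace T" "v \<in> topspace T"
      using that A U'_G by auto
    then have "gyr a u ` U' = U'"
      using U' by (simp add: invariant_nbhd_def)
    then obtain w where w: "w \<in> U'" "v = gyr a u w"
      using \<open>v \<in> U'\<close> by blast
    then have "op (op a u) v = op a (op u w)"
      using gyr_assoc[of a u w] au U'_G by auto
    then show ?thesis
      using U(2) UU that w by auto
  qed
  moreover have "M \<subseteq> topspace T"
    using A U'_G closed by (auto simp: M_def)
  ultimately have "strongly_within M B"
    using U' by (auto simp: strongly_within_def M_def)
  moreover have "strongly_within A M"
    using A U' by (auto simp: strongly_within_def M_def)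
  ultimately show ?thesis by blast
qed

lemma strongly_within_imp_subset:
  assumes "strongly_within A B"
  shows "A \<subseteq> B"
proof
  fix a assume "a \<in> A"
  moreover obtain U where "A \<subseteq> topspace T" "invariant_nbhd U" "\<forall>a\<in>A. \<forall>u\<in>U. op a u \<in> B"
    using assms by (auto simp: strongly_within_def)
  moreover have "zero \<in> U"
    using \<open>invariant_nbhd U\<close> by (auto simp: invariant_nbhd_def)
  ultimately show "a \<in> B"
    by (metis subsetD zero_right)
qed

lemma strongly_within_trans:
  assumes "strongly_within A B" "strongly_within B C"
  shows "strongly_within A C"
  using assms(1) subsetD[OF strongly_within_imp_subset[OF assms(2)]]
  unfolding strongly_within_def by fast

lemma strongly_within_imp_subset_interior:
  assumes "strongly_within A B"
  shows "A \<subseteq> T interior_of B"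
proof
  fix a assume a: "a \<in> A"
  obtain U where A: "A \<subseteq> topspace T" and U: "invariant_nbhd U" "\<forall>a\<in>A. \<forall>u\<in>U. op a u \<in> B"
    using assms by (auto simp: strongly_within_def)
  obtain V where V: "openin T V" "zero \<in> V" "V \<subseteq> U"
    using U by (auto simp: invariant_nbhd_def)
  have aG: "a \<in> topspace T" using a A by auto
  have "openin T (op a ` V)"
    using openin_left_translation[OF aG] V by simp
  moreover have "a \<in> op a ` V"
    using V aG by (metis imageI zero_right)
  moreover have "op a ` V \<subseteq> B"
    using V U a by blast
  ultimately show "a \<in> T interior_of B"
    unfolding interior_of_def by blast
qed

text \<open>For \<open>y\<close> in the closure some \<open>a = op y v\<close> lies in
  \<open>A\<close> with \<open>inv v\<close> in \<open>U\<close>. Then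
  \<open>op a (gyr y v (inv v)) = y\<close>, and invariance keeps the gyrated element in
  \<open>U\<close>.\<close>

lemma closure_subset_if_strongly_within:
  assumes "strongly_within A B"
  shows "T closure_of A \<subseteq> B"
proof
  fix y assume y: "y \<in> T closure_of A"
  obtain U where A: "A \<subseteq> topspace T" and U: "invariant_nbhd U" "\<forall>a\<in>A. \<forall>u\<in>U. op a u \<in> B"
    using assms by (auto simp: strongly_within_def)
  obtain V where V: "openin T V" "zero \<in> V" "V \<subseteq> U"
    using U by (auto simp: invariant_nbhd_def)
  have yG: "y \<in> topspace T" using y by (simp add: in_closure_of)
  define V' where "V' = {v \<in> topspace T. inv v \<in> V}"
  have V': "openin T V'" "zero \<in> V'"
    unfolding V'_def using openin_continuous_map_preimage[OF continuous_inv V(1)] V by auto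
  have "openin T (op y ` V')"
    using openin_left_translation[OF yG] V' by simp
  moreover have "y \<in> op y ` V'"
    using V' yG by (metis imageI zero_right)
  ultimately obtain a where "a \<in> A" "a \<in> op y ` V'"
    using y by (auto simp: in_closure_of)
  then obtain v where v: "v \<in> V'" "a = op y v" by auto
  then have vG: "v \<in> topspace T" "inv v \<in> U"
    using V by (auto simp: V'_def)
  have "op a (gyr y v (inv v)) = y"
    using gyr_assoc[of y v "inv v"] v vG yG by simp
  moreover have "gyr y v (inv v) \<in> U"
    using U(1) vG yG unfolding invariant_nbhd_def by blast
  ultimately show "y \<in> B"
    using U(2) \<open>a \<in> A\<close> by metis
qed

theorem completely_regular: "completely_regular_space T"
  unfolding completely_regular_space_def
proof (intro allI impI)
  fix S x assume "closedin T S \<and> x \<in> topspace T - S"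
  then have S: "openin T (topspace T - S)" and x: "x \<in> topspace T" "x \<notin> S" "S \<subseteq> topspace T"
    by (auto simp: closedin_def)
  define W where "W = {v \<in> topspace T. op x v \<in> topspace T - S}"
  have "openin T W" "zero \<in> W"
    unfolding W_def using x openin_continuous_map_preimage[OF _ S, of T "op x"]
      homeomorphic_imp_continuous_map[OF homeomorphic_map_left_translation] by auto
  then obtain U where U: "invariant_nbhd U" "U \<subseteq> W"
    using invariant_nbhd_within by blast
  then have base: "strongly_within {x} (topspace T - S)"
    using x by (auto simp: strongly_within_def W_def)
  \<comment> \<open>An interpolated set contains the closure of \<open>C\<close> and lies in the
    interior of \<open>D\<close>.\<close>
  have strong: "T closure_of C \<subseteq> T interior_of D" if "strongly_within C D" for C D
    using strongly_within_interpolate[OF that] closure_subset_if_strongly_within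
      strongly_within_imp_subset_interior by blast
  have sub: "C \<subseteq> topspace T" if "strongly_within C D" for C D
    using that by (simp add: strongly_within_def)
  obtain f :: "'a \<Rightarrow> real" where "continuous_map T (top_of_set {0..1}) f"
      "f ` {x} \<subseteq> {0}" "f ` (topspace T - (topspace T - S)) \<subseteq> {1}"
    by (rule separating_function[OF base strongly_within_interpolate strongly_within_trans strong sub])
  moreover have "topspace T - (topspace T - S) = S"
    using x(3) by blast
  ultimately show "\<exists>f::'a \<Rightarrow> real. continuous_map T (top_of_set {0..1}) f \<and> f x = 0 \<and> f ` S \<subseteq> {1}"
    by (intro exI[of _ f]) simp
qed

end

section \<open>Preimages under proper maps\<close>

lemma openin_if_continuous_absless:
  assumes "continuous_map X euclideanreal f"
  shows "openin X {x \<in> topspace X. \<bar>f x\<bar> < c}" "openin X {x \<in> topspace X. c < \<bar>f x\<bar>}"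
proof -
  have *: "continuous_map X euclideanreal (\<lambda>x. \<bar>f x\<bar>)"
    using assms by (rule continuous_map_real_abs)
  show "openin X {x \<in> topspace X. \<bar>f x\<bar> < c}" "openin X {x \<in> topspace X. c < \<bar>f x\<bar>}"
    using * unfolding continuous_map_upper_lower_semicontinuous_lt by auto
qed

lemma proper_map_tube:
  assumes f: "proper_map X Y f" and U: "openin X U" and y: "y \<in> topspace Y"
    and fibre: "\<And>x. \<lbrakk>x \<in> topspace X; f x = y\<rbrakk> \<Longrightarrow> x \<in> U"
  obtains N where "openin Y N" "y \<in> N" "\<And>x. \<lbrakk>x \<in> topspace X; f x \<in> N\<rbrakk> \<Longrightarrow> x \<in> U"
proof
  have "closedin X (topspace X - U)"
    using U by blast
  then have "closedin Y (f ` (topspace X - U))"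
    using f by (simp add: proper_map_def closed_map_def)
  then show "openin Y (topspace Y - f ` (topspace X - U))"
    by auto
qed (use y fibre in auto)

lemma compact_space_proper_map:
  assumes "proper_map X Y f" "compact_space Y"
  shows "compact_space X"
proof -
  have "{x \<in> topspace X. f x \<in> topspace Y} = topspace X"
    using proper_map_imp_subset_topspace[OF assms(1)] by auto
  then show ?thesis
    using compactin_proper_map_preimage[OF assms(1), of "topspace Y"] assms(2)
    by (simp add: compact_space_def)
qed

lemma sigma_compact_space_proper_map:
  assumes f: "proper_map X Y f" and "sigma_compact_space Y"
  shows "sigma_compact_space X"
proof -
  obtain \<K> where \<K>: "countable \<K>" "\<forall>K\<in>\<K>. compactin Y K" "\<Union>\<K> = topspace Y"
    using assms(2) by (auto simp: sigma_compact_space_def)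
  show ?thesis
    unfolding sigma_compact_space_def
  proof (intro exI conjI ballI)
    show "countable ((\<lambda>K. {x \<in> topspace X. f x \<in> K}) ` \<K>)"
      using \<K> by simp
    show "compactin X K" if "K \<in> (\<lambda>K. {x \<in> topspace X. f x \<in> K}) ` \<K>" for K
      using that \<K> compactin_proper_map_preimage[OF f] by auto
    show "\<Union> ((\<lambda>K. {x \<in> topspace X. f x \<in> K}) ` \<K>) = topspace X"
      using \<K>(3) proper_map_imp_subset_topspace[OF f] by auto
  qed
qed

text \<open>Each compact fibre is covered by a finite subfamily of \<open>\<U>\<close>, and
  closedness of \<open>f\<close> extends this to a neighbourhood \<open>N \<V>\<close> in
  \<open>Y\<close>. There are only countably many finite subfamilies, so countable compactness of
  \<open>Y\<close> applies to these neighbourhoods.\<close>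

lemma countably_compact_space_proper_map:
  assumes f: "proper_map X Y f" and Y: "countably_compact_space Y"
  shows "countably_compact_space X"
  unfolding countably_compact_space_def
proof (intro allI impI, elim conjE)
  fix \<U> assume \<U>: "countable \<U>" "\<forall>U\<in>\<U>. openin X U" "\<Union>\<U> = topspace X"
  define \<F> where "\<F> = {\<V>. \<V> \<subseteq> \<U> \<and> finite \<V>}"
  define N where "N = (\<lambda>\<V>. topspace Y - f ` (topspace X - \<Union>\<V>))"
  have N_open: "openin Y (N \<V>)" if "\<V> \<in> \<F>" for \<V>
  proof -
    have "closedin X (topspace X - \<Union>\<V>)"
      using that \<U> by (intro closedin_diff openin_Union) (auto simp: \<F>_def)
    then have "closedin Y (f ` (topspace X - \<Union>\<V>))"
      using f by (simp add: proper_map_def closed_map_def)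
    then show ?thesis
      by (auto simp: N_def)
  qed
  have "y \<in> \<Union>(N ` \<F>)" if y: "y \<in> topspace Y" for y
  proof -
    have "compactin X {x \<in> topspace X. f x = y}"
      using f y by (simp add: proper_map_def)
    then have "\<exists>\<V>. finite \<V> \<and> \<V> \<subseteq> \<U> \<and> {x \<in> topspace X. f x = y} \<subseteq> \<Union>\<V>"
      by (rule compactinD) (use \<U> in auto)
    then obtain \<V> where "finite \<V>" "\<V> \<subseteq> \<U>" "{x \<in> topspace X. f x = y} \<subseteq> \<Union>\<V>"
      by blast
    then show ?thesis
      using y by (auto simp: N_def \<F>_def)
  qed
  moreover have "N \<V> \<subseteq> topspace Y" for \<V>
    by (auto simp: N_def)
  ultimately have "\<Union>(N ` \<F>) = topspace Y"
    by blast
  moreover have "countable (N ` \<F>)"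
    using countable_Collect_finite_subset[OF \<U>(1)] by (simp add: \<F>_def conj_commute)
  moreover have "\<forall>U\<in>N ` \<F>. openin Y U"
    using N_open by blast
  ultimately obtain \<W> where "finite \<W>" "\<W> \<subseteq> N ` \<F>" "\<Union>\<W> = topspace Y"
    using Y[unfolded countably_compact_space_def, rule_format, of "N ` \<F>"] by auto
  then obtain \<J> where \<J>: "finite \<J>" "\<J> \<subseteq> \<F>" "\<Union>(N ` \<J>) = topspace Y"
    by (metis finite_subset_image)
  show "\<exists>\<V>. finite \<V> \<and> \<V> \<subseteq> \<U> \<and> \<Union>\<V> = topspace X"
  proof (intro exI conjI)
    show "finite (\<Union>\<J>)" "\<Union>\<J> \<subseteq> \<U>"
      using \<J> by (auto simp: \<F>_def)
    then have sub: "\<Union>(\<Union>\<J>) \<subseteq> topspace X"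
      using \<U>(3) Union_mono by metis
    have "x \<in> \<Union>(\<Union>\<J>)" if x: "x \<in> topspace X" for x
    proof -
      have "f x \<in> topspace Y"
        using x proper_map_imp_subset_topspace[OF f] by auto
      then obtain \<V> where "\<V> \<in> \<J>" "f x \<in> N \<V>"
        using \<J>(3) by blast
      then show ?thesis
        using x by (auto simp: N_def)
    qed
    then show "\<Union>(\<Union>\<J>) = topspace X"
      by (intro subset_antisym sub subsetI)
  qed
qed

text \<open>A limit point \<open>p\<close> of \<open>X\<close> in an extension \<open>Z\<close> along which \<open>f\<close> converges to a point of \<open>Y\<close>
  already lies in \<open>X\<close>. Both the Stone-Cech remainder and closed embeddings into powers of the
  line are pulled back along \<open>f\<close> by this principle.\<close>

lemma proper_map_limit_in_image:
  assumes f: "proper_map X Y f" and Z: "Hausdorff_space Z" and e: "continuous_map X Z e"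
    and C: "closedin X C" and p: "p \<in> Z closure_of (e ` C)" and y: "y \<in> topspace Y"
    and near: "\<And>N. \<lbrakk>openin Y N; y \<in> N\<rbrakk> \<Longrightarrow>
      \<exists>Q. openin Z Q \<and> p \<in> Q \<and> (\<forall>x\<in>topspace X. e x \<in> Q \<longrightarrow> f x \<in> N)"
  shows "p \<in> e ` C"
proof (rule ccontr)
  assume p': "p \<notin> e ` C"
  define K where "K = C \<inter> {x \<in> topspace X. f x = y}"
  have "compactin X K"
    unfolding K_def using f y C by (intro closed_Int_compactin) (simp_all add: proper_map_def)
  then have "compactin Z (e ` K)"
    using e image_compactin by blast
  moreover have "compactin Z {p}"
    using p by (simp add: in_closure_of)
  moreover have "disjnt (e ` K) {p}"
    using p' by (auto simp: K_def)
  ultimately obtain A B where AB: "openin Z A" "openin Z B" "e ` K \<subseteq> A" "p \<in> B" "disjnt A B"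
    using Hausdorff_space_compact_separation[OF Z] by (metis insert_subset)
  \<comment> \<open>\<open>U\<close> contains the fibre over \<open>y\<close>: its points in
    \<open>C\<close> are sent into \<open>A\<close>, the others are outside \<open>C\<close>.
    Properness then gives a neighbourhood of \<open>y\<close> over which all points of
    \<open>C\<close> are sent into \<open>A\<close>, away from \<open>p\<close>.\<close>
  define U where "U = {x \<in> topspace X. e x \<in> A} \<union> (topspace X - C)"
  have "openin X U"
    unfolding U_def using openin_continuous_map_preimage[OF e AB(1)] C by auto
  then obtain N where N: "openin Y N" "y \<in> N" "\<And>x. \<lbrakk>x \<in> topspace X; f x \<in> N\<rbrakk> \<Longrightarrow> x \<in> U"
    using proper_map_tube[OF f _ y, of U] AB(3) by (auto simp: U_def K_def)
  obtain Q where Q: "openin Z Q" "p \<in> Q" "\<forall>x\<in>topspace X. e x \<in> Q \<longrightarrow> f x \<in> N"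
    using near[OF N(1,2)] by blast
  have "openin Z (B \<inter> Q)" "p \<in> B \<inter> Q"
    using AB Q by auto
  then obtain x where x: "x \<in> C" "e x \<in> B \<inter> Q"
    using p unfolding in_closure_of by blast
  then have "x \<in> topspace X"
    using C closedin_subset by blast
  then have "x \<in> U"
    using x Q N by auto
  then show False
    using x AB(5) by (auto simp: U_def disjnt_iff)
qed

section \<open>Stone-Cech extension of maps and Cech-completeness\<close>

lemma gdelta_in_continuous_map_preimage:
  assumes g: "continuous_map Y X g" and S: "gdelta_in X S"
  shows "gdelta_in Y {y \<in> topspace Y. g y \<in> S}"
proof -
  obtain \<U> where \<U>: "countable \<U>" "\<U> \<subseteq> Collect (openin X)" "topspace X \<inter> \<Inter>\<U> = S"
    using S unfolding gdelta_in_def relative_to_def intersection_of_def by blast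
  let ?\<V> = "(\<lambda>U. {y \<in> topspace Y. g y \<in> U}) ` \<U>"
  have "{y \<in> topspace Y. g y \<in> S} = topspace Y \<inter> \<Inter>?\<V>"
    using \<U>(3) continuous_map_image_subset_topspace[OF g] by auto
  moreover have "(countable intersection_of openin Y) (\<Inter>?\<V>)"
    unfolding intersection_of_def using \<U>(1,2) openin_continuous_map_preimage[OF g]
    by (intro exI[of _ ?\<V>]) auto
  ultimately show ?thesis
    unfolding gdelta_in_def relative_to_def by blast
qed

lemma Hausdorff_stone_cech_cube: "Hausdorff_space (stone_cech_cube X)"
  unfolding stone_cech_cube_def by (simp add: Hausdorff_space_product_topology Hausdorff_space_subtopology)

lemma continuous_map_stone_cech_embedding:
  "continuous_map X (stone_cech_cube X) (stone_cech_embedding X)"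
  unfolding stone_cech_cube_def continuous_map_componentwise stone_cech_embedding_def
  by (auto simp: stone_cech_index_def)

lemma stone_cech_embedding_in_stone_cech:
  "stone_cech_embedding X ` topspace X \<subseteq> topspace (stone_cech X)"
proof -
  have "stone_cech_embedding X ` topspace X \<subseteq> topspace (stone_cech_cube X)"
    using continuous_map_image_subset_topspace[OF continuous_map_stone_cech_embedding] .
  then show ?thesis
    using closure_of_subset by (fastforce simp: stone_cech_def)
qed

text \<open>The functorial extension of \<open>f\<close>: a point of the cube assigns a number to
  each index function, and its image evaluates pullbacks along \<open>f\<close>. The
  \<open>restrict\<close> makes the pullback extensional, as \<open>stone_cech_index\<close>
  demands.\<close>

definition stone_cech_map ::
    "'a topology \<Rightarrow> 'b topology \<Rightarrow> ('a \<Rightarrow> 'b) \<Rightarrow> (('a \<Rightarrow> real) \<Rightarrow> real) \<Rightarrow> ('b \<Rightarrow> real) \<Rightarrow> real" where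
  "stone_cech_map X Y f p = (\<lambda>g\<in>stone_cech_index Y. p (restrict (g \<circ> f) (topspace X)))"

lemma stone_cech_index_compose:
  assumes "continuous_map X Y f" "g \<in> stone_cech_index Y"
  shows "restrict (g \<circ> f) (topspace X) \<in> stone_cech_index X"
proof -
  have "continuous_map X (top_of_set {0..1}) (g \<circ> f)"
    using assms continuous_map_compose by (fastforce simp: stone_cech_index_def)
  then show ?thesis
    by (auto simp: stone_cech_index_def intro: continuous_map_eq)
qed

lemma stone_cech_map_embedding:
  assumes "continuous_map X Y f" "x \<in> topspace X"
  shows "stone_cech_map X Y f (stone_cech_embedding X x) = stone_cech_embedding Y (f x)"
  using assms(2)
  by (auto simp: stone_cech_map_def stone_cech_embedding_def fun_eq_iff restrict_def
      dest: stone_cech_index_compose[OF assms(1)])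

lemma continuous_map_stone_cech_map:
  assumes "continuous_map X Y f"
  shows "continuous_map (stone_cech X) (stone_cech Y) (stone_cech_map X Y f)"
proof -
  have *: "continuous_map (stone_cech_cube X) (stone_cech_cube Y) (stone_cech_map X Y f)"
    unfolding stone_cech_cube_def continuous_map_componentwise
    by (auto simp: stone_cech_map_def
        intro!: continuous_map_product_projection stone_cech_index_compose[OF assms])
  have "stone_cech_map X Y f ` stone_cech_embedding X ` topspace X
      \<subseteq> stone_cech_embedding Y ` topspace Y"
    using stone_cech_map_embedding[OF assms] continuous_map_image_subset_topspace[OF assms] by auto
  then have "stone_cech_map X Y f ` (stone_cech_cube X closure_of stone_cech_embedding X ` topspace X)
      \<subseteq> stone_cech_cube Y closure_of (stone_cech_embedding Y ` topspace Y)"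
    by (rule order_trans[OF continuous_map_image_closure_subset[OF *] closure_of_mono])
  then show ?thesis
    unfolding stone_cech_def
    by (intro continuous_map_into_subtopology continuous_map_from_subtopology *) auto
qed

text \<open>Properness makes the preimage of the embedded \<open>Y\<close> under
  \<open>stone_cech_map X Y f\<close> exactly the embedded \<open>X\<close>, and a G-delta set pulls
  back to a G-delta set.\<close>

lemma Cech_complete_space_proper_map:
  assumes X: "Tychonoff_space X" and f: "proper_map X Y f" and cont: "continuous_map X Y f"
    and Y: "Cech_complete_space Y"
  shows "Cech_complete_space X"
proof -
  have Y': "completely_regular_space Y"
    and gd: "gdelta_in (stone_cech Y) (stone_cech_embedding Y ` topspace Y)"
    using Y by (auto simp: Cech_complete_space_def Tychonoff_space_def)
  let ?eX = "stone_cech_embedding X" and ?eY = "stone_cech_embedding Y"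
  let ?\<Phi> = "stone_cech_map X Y f"
  have "p \<in> ?eX ` topspace X"
    if p: "p \<in> topspace (stone_cech X)" and im: "?\<Phi> p \<in> ?eY ` topspace Y" for p
  proof -
    obtain y where y: "y \<in> topspace Y" "?\<Phi> p = ?eY y"
      using im by auto
    have pcl: "p \<in> stone_cech_cube X closure_of (?eX ` topspace X)"
      using p by (simp add: stone_cech_def)
    show ?thesis
    proof (rule proper_map_limit_in_image[OF f Hausdorff_stone_cech_cube
          continuous_map_stone_cech_embedding closedin_topspace pcl y(1)])
      fix N assume N: "openin Y N" "y \<in> N"
      then obtain g0 :: "_ \<Rightarrow> real" where g0: "continuous_map Y (top_of_set {0..1}) g0"
          "g0 y = 0" "g0 ` (topspace Y - N) \<subseteq> {1}"
        using Y' y unfolding completely_regular_space_def by (metis Diff_iff closedin_diff closedin_topspace)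
      define g where "g = restrict g0 (topspace Y)"
      have g: "g \<in> stone_cech_index Y"
        using g0(1) by (auto simp: g_def stone_cech_index_def intro: continuous_map_eq)
      define h where "h = restrict (g \<circ> f) (topspace X)"
      have h: "h \<in> stone_cech_index X"
        unfolding h_def by (rule stone_cech_index_compose[OF cont g])
      have "p h = ?eY y g"
        using fun_cong[OF y(2), of g] g by (simp add: stone_cech_map_def h_def)
      then have ph: "p h = 0"
        using g g0 y by (simp add: stone_cech_embedding_def g_def)
      \<comment> \<open>The neighbourhood of \<open>p\<close> is given by \<open>q h < 1\<close>:
        \<open>h\<close> is the pullback of \<open>g\<close>, which is 1 off \<open>N\<close>, so an
        embedded \<open>x\<close> in it has \<open>f x\<close> in \<open>N\<close>.\<close>
      have "continuous_map (stone_cech_cube X) euclideanreal (\<lambda>q. q h)"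
        using continuous_map_product_projection[OF h, of "\<lambda>_. top_of_set {0..1::real}"]
        unfolding stone_cech_cube_def continuous_map_in_subtopology by blast
      then have "openin (stone_cech_cube X) {q \<in> topspace (stone_cech_cube X). q h < 1}"
        by (simp add: continuous_map_upper_lower_semicontinuous_lt)
      moreover have "p \<in> {q \<in> topspace (stone_cech_cube X). q h < 1}"
        using ph pcl by (simp add: in_closure_of)
      moreover have "f x \<in> N" if x: "x \<in> topspace X" "?eX x h < 1" for x
      proof (rule ccontr)
        assume "f x \<notin> N"
        moreover have fx: "f x \<in> topspace Y"
          using x continuous_map_image_subset_topspace[OF cont] by auto
        ultimately have "g (f x) = 1"
          using g0 by (auto simp: g_def)
        then show False
          using x h by (simp add: stone_cech_embedding_def h_def)
      qed
      ultimately show "\<exists>Q. openin (stone_cech_cube X) Q \<and> p \<in> Q \<and>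
          (\<forall>x\<in>topspace X. ?eX x \<in> Q \<longrightarrow> f x \<in> N)"
        by (intro exI[of _ "{q \<in> topspace (stone_cech_cube X). q h < 1}"]) simp
    qed
  qed
  moreover have "?\<Phi> p \<in> ?eY ` topspace Y" if "p \<in> ?eX ` topspace X" for p
    using that stone_cech_map_embedding[OF cont] continuous_map_image_subset_topspace[OF cont] by auto
  ultimately have "{p \<in> topspace (stone_cech X). ?\<Phi> p \<in> ?eY ` topspace Y} = ?eX ` topspace X"
    using stone_cech_embedding_in_stone_cech[of X] by blast
  then show ?thesis
    using gdelta_in_continuous_map_preimage[OF continuous_map_stone_cech_map[OF cont] gd] X
    by (simp add: Cech_complete_space_def)
qed

text \<open>\<open>E\<close> evaluates at all continuous real functions on \<open>X\<close>.
  Projecting to the coordinates of \<open>e\<close> composed with \<open>f\<close> gives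
  \<open>\<Phi>\<close>, which turns \<open>E\<close> into \<open>e\<close> after \<open>f\<close>.
  As \<open>S\<close> is closed, \<open>\<Phi>\<close> sends limit points of the image of
  \<open>C\<close> into the image of \<open>Y\<close>, and the limit principle makes
  \<open>E\<close> a closed map; the Tychonoff property makes it injective.\<close>

lemma realcompact_space_proper_map:
  fixes X :: "'a topology" and Y :: "'b topology"
  assumes X: "Tychonoff_space X" and f: "proper_map X Y f" and cont: "continuous_map X Y f"
    and Y: "realcompact_space Y"
  shows "realcompact_space X"
proof -
  obtain J :: "('b \<Rightarrow> real) set" and S where S: "closedin (powertop_real J) S"
    and hom: "Y homeomorphic_space subtopology (powertop_real J) S"
    using Y by (auto simp: realcompact_space_def)
  obtain e where e: "homeomorphic_map Y (subtopology (powertop_real J) S) e"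
    using hom homeomorphic_space by blast
  have e_cont: "continuous_map Y (powertop_real J) e" and e_S: "e ` topspace Y = S"
    using homeomorphic_imp_continuous_map[OF e] homeomorphic_imp_surjective_map[OF e]
      closedin_subset[OF S]
    by (auto simp: continuous_map_in_subtopology)
  define I where "I = {h \<in> extensional (topspace X). continuous_map X euclideanreal h}"
  define E where "E = (\<lambda>x. \<lambda>h\<in>I. h x)"
  define k where "k = (\<lambda>j. restrict (\<lambda>x. e (f x) j) (topspace X))"
  have kI: "k j \<in> I" if "j \<in> J" for j
  proof -
    have "continuous_map Y euclideanreal (\<lambda>y. e y j)"
      using e_cont that by (simp add: continuous_map_componentwise)
    then have "continuous_map X euclideanreal (\<lambda>x. e (f x) j)"
      using continuous_map_compose[OF cont] by (auto simp: o_def)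
    then show ?thesis
      by (auto simp: I_def k_def intro: continuous_map_eq)
  qed
  define \<Phi> where "\<Phi> = (\<lambda>p :: ('a \<Rightarrow> real) \<Rightarrow> real. \<lambda>j\<in>J. p (k j))"
  have \<Phi>_cont: "continuous_map (powertop_real I) (powertop_real J) \<Phi>"
    unfolding continuous_map_componentwise
    by (auto simp: \<Phi>_def intro!: continuous_map_product_projection kI)
  have E_cont: "continuous_map X (powertop_real I) E"
    unfolding continuous_map_componentwise E_def by (auto simp: I_def)
  have fY: "f x \<in> topspace Y" if "x \<in> topspace X" for x
    using that continuous_map_image_subset_topspace[OF cont] by auto
  have \<Phi>_E: "\<Phi> (E x) = e (f x)" if x: "x \<in> topspace X" for x
  proof
    fix j
    have "e (f x) \<in> extensional J"
      using continuous_map_image_subset_topspace[OF e_cont] fY[OF x] by (auto simp: PiE_def)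
    then show "\<Phi> (E x) j = e (f x) j"
      using kI[of j] x by (auto simp: \<Phi>_def E_def k_def extensional_def)
  qed
  have Hausdorff: "Hausdorff_space (powertop_real I)"
    by (simp add: Hausdorff_space_product_topology)
  have "closed_map X (powertop_real I) E"
    unfolding closed_map_def
  proof (intro allI impI)
    fix C assume C: "closedin X C"
    have CX: "C \<subseteq> topspace X"
      using C closedin_subset by blast
    have "p \<in> E ` C" if p: "p \<in> powertop_real I closure_of (E ` C)" for p
    proof -
      have "\<Phi> ` (E ` C) \<subseteq> S"
        using \<Phi>_E CX fY e_S by auto
      then have "powertop_real J closure_of (\<Phi> ` (E ` C)) \<subseteq> S"
        using S by (simp add: closure_of_minimal)
      then have "\<Phi> p \<in> S"
        using continuous_map_image_closure_subset[OF \<Phi>_cont, of "E ` C"] p by blast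
      then obtain y where y: "y \<in> topspace Y" "\<Phi> p = e y"
        using e_S by auto
      show ?thesis
      proof (rule proper_map_limit_in_image[OF f Hausdorff E_cont C p y(1)])
        fix N assume N: "openin Y N" "y \<in> N"
        have NY: "N \<subseteq> topspace Y"
          using N openin_subset by blast
        then have "openin (subtopology (powertop_real J) S) (e ` N)"
          using homeomorphic_map_openness[OF e] N by blast
        then obtain Q where Q: "openin (powertop_real J) Q" "e ` N = Q \<inter> S"
          by (auto simp: openin_subtopology)
        have inj: "inj_on e (topspace Y)"
          using homeomorphic_imp_injective_map[OF e] .
        let ?P = "{q \<in> topspace (powertop_real I). \<Phi> q \<in> Q}"
        have "openin (powertop_real I) ?P"
          using openin_continuous_map_preimage[OF \<Phi>_cont Q(1)] .
        moreover have "p \<in> ?P"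
          using p y N Q by (auto simp: in_closure_of)
        moreover have "f x \<in> N" if x: "x \<in> topspace X" "E x \<in> ?P" for x
        proof -
          have "e (f x) \<in> e ` N"
            using Q x \<Phi>_E fY e_S by auto
          then show ?thesis
            using inj_on_image_mem_iff[OF inj] fY[OF x(1)] NY by blast
        qed
        ultimately show "\<exists>Q. openin (powertop_real I) Q \<and> p \<in> Q \<and>
            (\<forall>x\<in>topspace X. E x \<in> Q \<longrightarrow> f x \<in> N)"
          by blast
      qed
    qed
    moreover have "E ` C \<subseteq> topspace (powertop_real I)"
      using continuous_map_image_subset_topspace[OF E_cont] CX by blast
    ultimately show "closedin (powertop_real I) (E ` C)"
      by (metis closure_of_subset closure_of_eq subsetI subset_antisym)
  qed
  moreover have "inj_on E (topspace X)"
  proof (rule inj_onI, rule ccontr)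
    fix x y assume xy: "x \<in> topspace X" "y \<in> topspace X" "E x = E y" "x \<noteq> y"
    have "closedin X {y}"
      using X xy by (simp add: Tychonoff_space_def closedin_Hausdorff_singleton)
    then obtain g0 :: "'a \<Rightarrow> real" where g0: "continuous_map X (top_of_set {0..1}) g0"
        "g0 x = 0" "g0 ` {y} \<subseteq> {1}"
      using X xy unfolding Tychonoff_space_def completely_regular_space_def by (metis Diff_iff singletonD)
    define g where "g = restrict g0 (topspace X)"
    have "g \<in> I"
      using g0(1) by (auto simp: g_def I_def continuous_map_in_subtopology intro: continuous_map_eq)
    then have "g x = g y"
      using fun_cong[OF xy(3), of g] by (simp add: E_def)
    then show False
      using g0 xy by (simp add: g_def)
  qed
  ultimately have "embedding_map X (powertop_real I) E"
    and "closedin (powertop_real I) (E ` topspace X)"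
    using injective_closed_imp_embedding_map[OF E_cont] by (auto simp: closed_map_def)
  then show ?thesis
    using X embedding_map_imp_homeomorphic_space unfolding realcompact_space_def by blast
qed

text \<open>Choose \<open>x n\<close> in \<open>W n\<close> and a nonnegative bump function
  \<open>h n\<close> that is 1 at \<open>x n\<close> and 0 off \<open>W n\<close>. By local
  finiteness the sum of the functions \<open>real n * h n y\<close> is continuous, and it is at
  least \<open>n\<close> at \<open>x n\<close>.\<close>

lemma pseudocompact_space_no_discrete_open_sequence:
  fixes W :: "nat \<Rightarrow> 'a set"
  assumes Y: "pseudocompact_space Y" and W: "\<And>n. openin Y (W n)" "\<And>n. W n \<noteq> {}"
    and finite: "\<And>y. y \<in> topspace Y \<Longrightarrow> \<exists>V m. openin Y V \<and> y \<in> V \<and> (\<forall>n\<ge>m. V \<inter> W n = {})"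
  shows False
proof -
  have "\<exists>x. x \<in> W n" for n
    using W(2) by blast
  then obtain x where x: "\<And>n. x n \<in> W n"
    by metis
  have "\<exists>h. continuous_map Y euclideanreal h \<and> h (x n) = 1 \<and> (\<forall>y\<in>topspace Y - W n. h y = 0) \<and> (\<forall>y\<in>topspace Y. 0 \<le> h y)" for n
  proof -
    have "closedin Y (topspace Y - W n)" "x n \<in> topspace Y - (topspace Y - W n)"
      using W(1)[of n] x[of n] openin_subset by (auto simp: closedin_diff)
    then obtain g :: "'a \<Rightarrow> real" where g: "continuous_map Y (top_of_set {0..1}) g"
        "g (x n) = 0" "g ` (topspace Y - W n) \<subseteq> {1}"
      using Y unfolding pseudocompact_space_def Tychonoff_space_def completely_regular_space_def by blast
    then have "continuous_map Y euclideanreal g" "\<forall>y\<in>topspace Y. g y \<le> 1"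
      by (auto simp: continuous_map_in_subtopology)
    then show ?thesis
      using g by (intro exI[of _ "\<lambda>y. 1 - g y"]) (auto intro!: continuous_intros)
  qed
  then obtain h where h: "\<And>n. continuous_map Y euclideanreal (h n)" "\<And>n. h n (x n) = 1"
    "\<And>n y. y \<in> topspace Y - W n \<Longrightarrow> h n y = 0" "\<And>n y. y \<in> topspace Y \<Longrightarrow> 0 \<le> h n y"
    by metis
  \<comment> \<open>Local finiteness makes the index set finite at every point of \<open>Y\<close>,
    so the default value 0 of sums over infinite sets does not occur there.\<close>
  define F where "F = (\<lambda>y. \<Sum>n | y \<in> W n. real n * h n y)"
  have local: "\<exists>V m. openin Y V \<and> y \<in> V \<and> (\<forall>z\<in>V. F z = (\<Sum>n<m. real n * h n z) \<and> {n. z \<in> W n} \<subseteq> {..<m})"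
    if y: "y \<in> topspace Y" for y
  proof -
    obtain V m where V: "openin Y V" "y \<in> V" "\<forall>n\<ge>m. V \<inter> W n = {}"
      using finite[OF y] by blast
    have "F z = (\<Sum>n<m. real n * h n z) \<and> {n. z \<in> W n} \<subseteq> {..<m}" if z: "z \<in> V" for z
    proof
      show sub: "{n. z \<in> W n} \<subseteq> {..<m}"
        using V(3) z not_less by auto
      show "F z = (\<Sum>n<m. real n * h n z)"
        unfolding F_def by (rule sum.mono_neutral_left) (use sub h(3) z openin_subset[OF V(1)] in auto)
    qed
    then show ?thesis
      using V by blast
  qed
  have "continuous_map Y euclideanreal F"
    unfolding continuous_map_def
  proof (intro conjI allI impI)
    fix S :: "real set" assume S: "openin euclideanreal S"
    show "openin Y {y \<in> topspace Y. F y \<in> S}"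
    proof (subst openin_subopen, intro ballI)
      fix y assume "y \<in> {y \<in> topspace Y. F y \<in> S}"
      then have y: "y \<in> topspace Y" "F y \<in> S" by auto
      obtain V m where V: "openin Y V" "y \<in> V" "\<forall>z\<in>V. F z = (\<Sum>n<m. real n * h n z)"
        using local[OF y(1)] by blast
      have "continuous_map Y euclideanreal (\<lambda>z. \<Sum>n<m. real n * h n z)"
        using h(1) by (intro continuous_intros) auto
      then have "openin Y {z \<in> topspace Y. (\<Sum>n<m. real n * h n z) \<in> S}"
        using S openin_continuous_map_preimage by blast
      then have "openin Y (V \<inter> {z \<in> topspace Y. (\<Sum>n<m. real n * h n z) \<in> S})"
        using V(1) by blast
      moreover have "y \<in> V \<inter> {z \<in> topspace Y. (\<Sum>n<m. real n * h n z) \<in> S}"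
        using V y by auto
      moreover have "V \<inter> {z \<in> topspace Y. (\<Sum>n<m. real n * h n z) \<in> S} \<subseteq> {y \<in> topspace Y. F y \<in> S}"
        using V(3) by auto
      ultimately show "\<exists>T. openin Y T \<and> y \<in> T \<and> T \<subseteq> {y \<in> topspace Y. F y \<in> S}"
        by blast
    qed
  qed auto
  then have "bounded (F ` topspace Y)"
    using Y by (simp add: pseudocompact_space_def)
  then obtain B where B: "\<And>y. y \<in> topspace Y \<Longrightarrow> \<bar>F y\<bar> \<le> B"
    unfolding bounded_iff by auto
  obtain n where n: "B < real n"
    using reals_Archimedean2 by blast
  have xn: "x n \<in> topspace Y"
    using x W(1) openin_subset by blast
  obtain V m where "x n \<in> V" "\<forall>z\<in>V. F z = (\<Sum>n<m. real n * h n z) \<and> {n. z \<in> W n} \<subseteq> {..<m}"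
    using local[OF xn] by blast
  then have "F (x n) = (\<Sum>i<m. real i * h i (x n))" "n < m"
    using x by auto
  moreover have "real n * h n (x n) \<le> (\<Sum>i<m. real i * h i (x n))"
    by (rule member_le_sum) (use \<open>n < m\<close> h(4) xn in auto)
  ultimately have "real n \<le> F (x n)"
    using h(2) by simp
  then show False
    using B[OF xn] n by linarith
qed

text \<open>An unbounded \<open>f\<close> is unbounded on the dense part \<open>U\<close>, so the
  sets \<open>W n\<close> are nonempty; they are open as \<open>p\<close> is open. They are locally
  finite since \<open>f\<close> is bounded on each compact fibre, and a tube around the fibre gives
  a neighbourhood that misses \<open>W n\<close> for large \<open>n\<close>.\<close>

lemma pseudocompact_space_closure_open_proper_map:
  assumes T: "Tychonoff_space T" and U: "openin T U" and N: "openin Q N"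
    and open_map: "open_map T Q p" and UN: "p ` U \<subseteq> N"
    and proper: "proper_map (subtopology T (T closure_of U)) Q p"
    and pseudo: "pseudocompact_space (subtopology Q (Q closure_of N))"
  shows "pseudocompact_space (subtopology T (T closure_of U))"
  unfolding pseudocompact_space_def
proof (intro conjI allI impI)
  let ?F = "T closure_of U"
  let ?X = "subtopology T ?F" and ?Y = "subtopology Q (Q closure_of N)"
  show "Tychonoff_space ?X"
    using T by (simp add: Tychonoff_space_def completely_regular_space_subtopology Hausdorff_space_subtopology)
  have UF: "U \<subseteq> ?F"
    using U by (simp add: closure_of_subset openin_subset)
  have topX: "topspace ?X = ?F"
    by (simp add: Int_absorb1 closure_of_subset_topspace)
  have NcN: "N \<subseteq> Q closure_of N"
    using N by (simp add: closure_of_subset openin_subset)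
  fix f assume f: "continuous_map ?X euclideanreal f"
  define W where "W = (\<lambda>n::nat. p ` {x \<in> U. real n < \<bar>f x\<bar>})"
  show "bounded (f ` topspace ?X)"
  proof (rule ccontr)
    assume unbounded: "\<not> bounded (f ` topspace ?X)"
    \<comment> \<open>Openness of \<open>p\<close> concerns open sets of \<open>T\<close>, so the
      relatively open set where \<open>real n < \<bar>f x\<bar>\<close> is written as the trace of
      an open set of \<open>T\<close>, to be intersected with \<open>U\<close>.\<close>
    have "\<exists>V. openin T V \<and> (\<forall>x\<in>?F. x \<in> V \<longleftrightarrow> real n < \<bar>f x\<bar>)" for n
    proof -
      have "openin ?X {x \<in> topspace ?X. real n < \<bar>f x\<bar>}"
        using openin_if_continuous_absless[OF f] by blast
      then obtain V where "openin T V" "{x \<in> topspace ?X. real n < \<bar>f x\<bar>} = V \<inter> ?F"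
        by (auto simp: openin_subtopology)
      then show ?thesis
        using topX by (intro exI[of _ V]) auto
    qed
    then obtain V where V: "\<And>n. openin T (V n)" "\<And>n x. x \<in> ?F \<Longrightarrow> x \<in> V n \<longleftrightarrow> real n < \<bar>f x\<bar>"
      by metis
    have W_eq: "W n = p ` (U \<inter> V n)" for n
      unfolding W_def using UF V(2) by (intro arg_cong[where f = "image p"]) auto
    have "openin ?Y (W n)" for n
    proof -
      have "openin Q (W n)"
        using open_map U V(1) unfolding open_map_def W_eq by blast
      moreover have "W n \<subseteq> Q closure_of N"
        using UN NcN by (auto simp: W_def)
      ultimately show ?thesis
        using openin_subtopology_Int[of Q "W n" "Q closure_of N"] by (simp add: Int_absorb2)
    qed
    moreover have "W n \<noteq> {}" for n
    proof -
      obtain x where "x \<in> ?F" "real n < \<bar>f x\<bar>"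
        using unbounded topX unfolding bounded_iff by (auto simp: not_le)
      then have "x \<in> V n"
        using V(2) by simp
      then obtain u where "u \<in> U" "u \<in> V n"
        using V(1)[of n] \<open>x \<in> ?F\<close> unfolding in_closure_of by blast
      then show ?thesis
        unfolding W_eq by blast
    qed
    moreover have "\<exists>V m. openin ?Y V \<and> y \<in> V \<and> (\<forall>n\<ge>m. V \<inter> W n = {})" if y: "y \<in> topspace ?Y" for y
    proof -
      have yQ: "y \<in> topspace Q"
        using y by simp
      have "compactin ?X {x \<in> topspace ?X. p x = y}"
        using proper yQ by (simp add: proper_map_def)
      then have "compactin euclideanreal (f ` {x \<in> topspace ?X. p x = y})"
        using f image_compactin by blast
      then have "bounded (f ` {x \<in> topspace ?X. p x = y})"
        by (simp add: compact_imp_bounded)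
      then obtain B where B: "\<And>x. \<lbrakk>x \<in> topspace ?X; p x = y\<rbrakk> \<Longrightarrow> \<bar>f x\<bar> \<le> B"
        unfolding bounded_iff by auto
      obtain m where m: "B < real m"
        using reals_Archimedean2 by blast
      have less: "openin ?X {x \<in> topspace ?X. \<bar>f x\<bar> < real m}"
        using openin_if_continuous_absless[OF f] by blast
      have fibre: "x \<in> {x \<in> topspace ?X. \<bar>f x\<bar> < real m}" if "x \<in> topspace ?X" "p x = y" for x
        using that order.strict_trans1[OF B m] by blast
      obtain A where A: "openin Q A" "y \<in> A"
          "\<And>x. \<lbrakk>x \<in> topspace ?X; p x \<in> A\<rbrakk> \<Longrightarrow> x \<in> {x \<in> topspace ?X. \<bar>f x\<bar> < real m}"
        using proper_map_tube[OF proper less yQ fibre] by blast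
      have "openin ?Y (A \<inter> Q closure_of N)"
        using A(1) by (rule openin_subtopology_Int)
      moreover have "A \<inter> Q closure_of N \<inter> W n = {}" if "m \<le> n" for n
      proof -
        have "p x \<notin> A" if "x \<in> U" "real n < \<bar>f x\<bar>" for x
          using A(3)[of x] that UF topX \<open>m \<le> n\<close> by auto
        then show ?thesis
          by (auto simp: W_def)
      qed
      ultimately show ?thesis
        using A y by (intro exI[of _ "A \<inter> Q closure_of N"] exI[of _ m]) auto
    qed
    ultimately show False
      using pseudocompact_space_no_discrete_open_sequence[OF pseudo, of W] by blast
  qed
qed

section \<open>The coset map\<close>

locale gyrogroup_quotient =
  strongly_topological_gyrogroup T op gyr + gyrogroup_strong_sub "topspace T" op gyr H
  for T :: "'a topology" and op gyr H +
  assumes locally_compact: "locally_has compact_space (subtopology T H)"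
begin

abbreviation quotient :: "'a set topology" where "quotient \<equiv> gyro_quotient T op H"

lemma quotient_map_coset: "quotient_map T quotient coset"
  unfolding gyro_quotient_def by (rule quotient_map_quotient_topology)

lemma topspace_quotient: "topspace quotient = coset ` topspace T"
  by (simp add: gyro_quotient_def)

text \<open>The saturation of \<open>U\<close> is the union of its right translates by elements of
  \<open>H\<close>, and right translations are homeomorphisms.\<close>

lemma open_map_coset: "open_map T quotient coset"
  unfolding open_map_def
proof (intro allI impI)
  fix U assume U: "openin T U"
  have UG: "U \<subseteq> topspace T"
    using U openin_subset by blast
  have "{x \<in> topspace T. coset x \<in> coset ` U} = (\<Union>h\<in>H. (\<lambda>x. op x h) ` U)"
  proof (intro subset_antisym subsetI)
    fix x assume "x \<in> {x \<in> topspace T. coset x \<in> coset ` U}"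
    then obtain u where "x \<in> topspace T" "u \<in> U" "coset u = coset x"
      by auto
    then show "x \<in> (\<Union>h\<in>H. (\<lambda>x. op x h) ` U)"
      using coset_eq_iff[of u x] UG by auto
  next
    fix x assume "x \<in> (\<Union>h\<in>H. (\<lambda>x. op x h) ` U)"
    then obtain u h where "u \<in> U" "h \<in> H" "x = op u h"
      by auto
    then show "x \<in> {x \<in> topspace T. coset x \<in> coset ` U}"
      using coset_op[of u h] UG closed by auto
  qed
  moreover have "openin T (\<Union>h\<in>H. (\<lambda>x. op x h) ` U)"
    using homeomorphic_map_openness[OF homeomorphic_map_right_translation UG] U by auto
  ultimately show "openin quotient (coset ` U)"
    using UG by (auto simp: gyro_quotient_def openin_quotient_topology)
qed

text \<open>Local compactness of \<open>H\<close> at \<open>zero\<close> in terms of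
  \<open>T\<close>: the elements of \<open>H\<close> near \<open>zero\<close> lie in one compact
  set, whose left translates will bound parts of cosets.\<close>

lemma compact_core:
  obtains V K where "openin T V" "zero \<in> V" "compactin T K" "K \<subseteq> H" "H \<inter> V \<subseteq> K"
proof -
  have "zero \<in> topspace (subtopology T H)"
    using H_zero by simp
  then obtain U where U: "openin (subtopology T H) U" "zero \<in> U"
      and compact: "compact_space (subtopology (subtopology T H) (subtopology T H closure_of U))"
    using locally_compact unfolding locally_has_def by blast
  obtain V where V: "openin T V" "U = V \<inter> H"
    using U by (auto simp: openin_subtopology)
  define K where "K = subtopology T H closure_of U"
  have "compactin (subtopology T H) K"
    using compact closure_of_subset_topspace[of "subtopology T H" U]
    unfolding K_def by (simp add: compactin_subspace)
  then have "compactin T K" "K \<subseteq> H"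
    by (auto simp: compactin_subtopology)
  moreover have "U \<subseteq> K"
    unfolding K_def by (rule closure_of_subset[OF openin_subset[OF U(1)]])
  ultimately show thesis
    using that V U(2) by blast
qed

text \<open>If \<open>\<pi>(x)\<close> is in the closure of \<open>\<pi>(C)\<close>, then, since right translations are open, for each
  neighbourhood \<open>W'\<close> of \<open>0\<close> some \<open>w \<oplus> (x \<oplus> h)\<close> with \<open>w \<in> W'\<close> lies in \<open>C\<close>. As \<open>C\<close> is small, all these
  points \<open>x \<oplus> h\<close> lie in one compact translate of \<open>K\<close>, which therefore meets \<open>C\<close>.\<close>

lemma local_proper_map:
  obtains W where "openin T W" "zero \<in> W"
    "\<And>F. \<lbrakk>closedin T F; F \<subseteq> W\<rbrakk> \<Longrightarrow> proper_map (subtopology T F) quotient coset"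
proof -
  obtain V K where V: "openin T V" "zero \<in> V" and K: "compactin T K" "K \<subseteq> H" "H \<inter> V \<subseteq> K"
    using compact_core by blast
  \<comment> \<open>Continuity at \<open>zero\<close> makes \<open>W\<close> so small that products
    \<open>op a b\<close> and \<open>op c d\<close> of elements of \<open>W\<close> differ, on the
    left, by an element of \<open>V\<close>. Fibres inside \<open>F\<close> use single elements of
    \<open>W\<close>, padded by \<open>zero\<close>; the closedness argument uses genuine
    products.\<close>
  have "continuous_map (prod_topology T T) T (\<lambda>(x, y). op (inv x) y)"
    unfolding case_prod_unfold
    by (intro continuous_intros continuous_map_fst continuous_map_snd)
  then obtain A B where AB: "openin T A" "openin T B" "zero \<in> A" "zero \<in> B"
      "\<And>u v. \<lbrakk>u \<in> A; v \<in> B\<rbrakk> \<Longrightarrow> op (inv u) v \<in> V"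
    by (rule continuous_map_prod_nhds[OF _ V(1), of _ _ _ zero zero]) (use V in auto)
  have "openin T (A \<inter> B)"
    using AB by blast
  then obtain W1 W2 where W12: "openin T W1" "openin T W2" "zero \<in> W1" "zero \<in> W2"
      "\<And>u v. \<lbrakk>u \<in> W1; v \<in> W2\<rbrakk> \<Longrightarrow> op u v \<in> A \<inter> B"
    by (rule continuous_map_prod_nhds[OF continuous_op, of _ zero zero]) (use AB in auto)
  define W where "W = W1 \<inter> W2"
  have W: "openin T W" "zero \<in> W"
    using W12 by (auto simp: W_def)
  have WG: "W \<subseteq> topspace T"
    using W(1) openin_subset by blast
  have small: "op (inv (op a b)) (op c d) \<in> V" if "a \<in> W" "b \<in> W" "c \<in> W" "d \<in> W" for a b c d
    using AB(5)[of "op a b" "op c d"] W12(5)[of a b] W12(5)[of c d] that by (auto simp: W_def)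
  show thesis
  proof (rule that[OF W])
    fix F assume F: "closedin T F" "F \<subseteq> W"
    have FG: "F \<subseteq> topspace T"
      using F closedin_subset by blast
    have in_K: "\<exists>k\<in>K. y = op x k"
      if xy: "x \<in> topspace T" "y \<in> topspace T" "coset x = coset y" "op (inv x) y \<in> V" for x y
    proof -
      obtain h where "h \<in> H" "y = op x h"
        using coset_eq_iff[OF xy(1,2)] xy(3) by auto
      then show ?thesis
        using xy K(3) by auto
    qed
    have compact_translate: "compactin T (op x ` K)" if "x \<in> topspace T" for x
      using image_compactin[OF K(1)] homeomorphic_imp_continuous_map
        homeomorphic_map_left_translation[OF that] by blast
    have closed_map: "closedin quotient (coset ` C)" if C: "closedin (subtopology T F) C" for C
    proof -
      have CT: "closedin T C" and CF: "C \<subseteq> F"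
        using C F by (auto simp: closedin_closed_subtopology)
      \<comment> \<open>As \<open>coset\<close> is a quotient map, it suffices that the saturation
        of \<open>C\<close> is closed.\<close>
      define S where "S = {x \<in> topspace T. coset x \<in> coset ` C}"
      have "x \<in> S" if x: "x \<in> T closure_of S" for x
      proof (rule ccontr)
        assume xS: "x \<notin> S"
        have xG: "x \<in> topspace T"
          using x by (simp add: in_closure_of)
        have near: "\<exists>w\<in>W'. \<exists>c\<in>C. \<exists>h\<in>H. c = op w (op x h)" if W': "openin T W'" "zero \<in> W'" for W'
        proof -
          have W'G: "W' \<subseteq> topspace T"
            using W'(1) openin_subset by blast
          have "openin T ((\<lambda>w. op w x) ` W')"
            using homeomorphic_map_openness[OF homeomorphic_map_right_translation[OF xG] W'G] W' by blast
          moreover have "x \<in> (\<lambda>w. op w x) ` W'"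
            using W'(2) xG by (force intro: image_eqI[of _ _ zero])
          ultimately obtain s where "s \<in> S" "s \<in> (\<lambda>w. op w x) ` W'"
            using x[unfolded in_closure_of, THEN conjunct2, rule_format] by metis
          then obtain w where w: "w \<in> W'" "op w x \<in> S"
            by auto
          then obtain c where c: "c \<in> C" "coset (op w x) = coset c"
            by (auto simp: S_def)
          then obtain h where "h \<in> H" "c = op (op w x) h"
            using coset_eq_iff[of "op w x" c] w CF FG by (auto simp: S_def)
          moreover from this obtain k where "k \<in> H" "op (op w x) h = op w (op x k)"
            using coset_translate[of w x h] w(1) W'G xG by blast
          ultimately show ?thesis
            using w(1) c(1) by auto
        qed
        \<comment> \<open>Bounding the inverse too makes \<open>op x h = op (inv w) c\<close> a
          product of two elements of \<open>W\<close> when \<open>w\<close> is in \<open>W'\<close>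
          and \<open>c = op w (op x h)\<close> is in \<open>C\<close>. One such point
          \<open>z\<close> is fixed as reference; all others then lie in the compact set
          \<open>D\<close>.\<close>
        define W' where "W' = W \<inter> {w \<in> topspace T. inv w \<in> W}"
        have W': "openin T W'" "zero \<in> W'"
          unfolding W'_def using W openin_continuous_map_preimage[OF continuous_inv W(1)] by auto
        obtain w0 c0 h0 where 0: "w0 \<in> W'" "c0 \<in> C" "h0 \<in> H" "c0 = op w0 (op x h0)"
          using near[OF W'] by blast
        define z where "z = op x h0"
        have zG: "z \<in> topspace T" and coset_z: "coset z = coset x"
          using 0 xG closed coset_op by (auto simp: z_def)
        have z: "z = op (inv w0) c0"
          using 0 xG closed by (simp add: z_def W'_def)
        define D where "D = op z ` K"
        have D: "compactin T D"
          unfolding D_def by (rule compact_translate[OF zG])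
        have disjoint: "d \<notin> C" if "d \<in> D" for d
        proof
          assume "d \<in> C"
          have "coset d = coset x"
            using that coset_op[OF zG] K(2) coset_z by (auto simp: D_def)
          then have "coset x \<in> coset ` C"
            using imageI[OF \<open>d \<in> C\<close>, of coset] by simp
          then show False
            using xS xG by (simp add: S_def)
        qed
        \<comment> \<open>\<open>D\<close> misses \<open>C\<close>, so by Wallace's theorem
          \<open>zero\<close> has a neighbourhood \<open>M\<close> with \<open>op w d\<close>
          outside \<open>C\<close> for \<open>w\<close> in \<open>M\<close> and \<open>d\<close> in
          \<open>D\<close>. Applying \<open>near\<close> inside \<open>M\<close> contradicts
          this.\<close>
        define P where "P = {q \<in> topspace (prod_topology T T). (\<lambda>(x, y). op x y) q \<in> topspace T - C}"
        have "openin (prod_topology T T) P"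
          unfolding P_def using CT by (intro openin_continuous_map_preimage[OF continuous_op]) auto
        moreover have "{zero} \<times> D \<subseteq> P"
          using disjoint subsetD[OF compactin_subset_topspace[OF D]] by (auto simp: P_def)
        moreover have "compactin T {zero}"
          by simp
        ultimately obtain M N where MN: "openin T M" "{zero} \<subseteq> M" "D \<subseteq> N" "M \<times> N \<subseteq> P"
          using Wallace_theorem_prod_topology[OF _ D] by metis
        obtain w c h where w: "w \<in> M \<inter> W'" "c \<in> C" "h \<in> H" "c = op w (op x h)"
          using near[of "M \<inter> W'"] MN W' by auto
        define y where "y = op x h"
        have yG: "y \<in> topspace T" and coset_y: "coset y = coset z"
          using w xG closed coset_op coset_z by (auto simp: y_def)
        have y: "y = op (inv w) c"
          using w xG closed by (simp add: y_def W'_def)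
        have "op (inv z) y \<in> V"
          unfolding z y using small[of "inv w0" c0 "inv w" c] 0 w CF F by (auto simp: W'_def)
        then have "y \<in> D"
          using in_K[OF zG yG] coset_y by (auto simp: D_def)
        then have "(w, y) \<in> P"
          using MN w by blast
        then show False
          using w by (auto simp: P_def y_def)
      qed
      then have "T closure_of S \<subseteq> S"
        by (rule subsetI)
      moreover have "S \<subseteq> topspace T"
        by (auto simp: S_def)
      ultimately have "closedin T S"
        using closure_of_subset_eq by blast
      moreover have "coset ` C \<subseteq> topspace quotient"
        using CF FG by (auto simp: topspace_quotient)
      ultimately show ?thesis
        using quotient_map_coset unfolding quotient_map_closedin S_def by blast
    qed
    \<comment> \<open>The fibre through a point \<open>z\<close> of \<open>F\<close> is the closed
      set \<open>F\<close> intersected with the left translate of \<open>K\<close> by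
      \<open>z\<close>.\<close>
    have "compactin (subtopology T F) {x \<in> topspace (subtopology T F). coset x = y}" for y
    proof (cases "\<exists>z\<in>F. coset z = y")
      case True
      then obtain z where z: "z \<in> F" "coset z = y" by blast
      have zG: "z \<in> topspace T"
        using z FG by blast
      have "x \<in> op z ` K" if "x \<in> F" "coset x = y" for x
      proof -
        have "x \<in> W" "z \<in> W" "x \<in> topspace T"
          using that(1) z(1) F(2) FG by auto
        then have "op (inv z) x \<in> V"
          using small[of zero z zero x] W(2) zG by simp
        then show ?thesis
          using in_K[OF zG, of x] that z FG by auto
      qed
      moreover have "coset x = y" if "x \<in> op z ` K" for x
        using that coset_op[OF zG] K(2) z(2) by auto
      ultimately have "{x \<in> topspace (subtopology T F). coset x = y} = F \<inter> op z ` K"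
        using FG by auto
      moreover have "compactin T (F \<inter> op z ` K)"
        using F(1) compact_translate[OF zG] by (rule closed_Int_compactin)
      ultimately show ?thesis
        by (simp add: compactin_subtopology)
    next
      case False
      then have "{x \<in> topspace (subtopology T F). coset x = y} = {}"
        by auto
      then show ?thesis
        by (simp only: compactin_empty)
    qed
    then show "proper_map (subtopology T F) quotient coset"
      using closed_map by (simp add: proper_map_def closed_map_def)
  qed
qed

section \<open>Transfer of local properties from the quotient\<close>

lemma Tychonoff: "Tychonoff_space T"
  using completely_regular Hausdorff by (simp add: Tychonoff_space_def)

text \<open>\<open>p\<close> is \<open>coset\<close> after translation by \<open>inv g\<close>,
  which moves \<open>g\<close> to \<open>zero\<close>, so one neighbourhood \<open>N\<close> of
  \<open>coset zero\<close> serves every \<open>g\<close>. Regularity of \<open>T\<close> puts a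
  closed neighbourhood of \<open>zero\<close> inside the preimage of \<open>N\<close> and the set
  \<open>W\<close> of \<open>local_proper_map\<close>.\<close>

lemma local_structure:
  assumes N: "openin quotient N" "coset zero \<in> N" and g: "g \<in> topspace T"
  obtains U p where "openin T U" "g \<in> U" "continuous_map T quotient p" "open_map T quotient p"
    "p ` (T closure_of U) \<subseteq> N" "proper_map (subtopology T (T closure_of U)) quotient p"
proof -
  obtain W where W: "openin T W" "zero \<in> W"
      "\<And>F. \<lbrakk>closedin T F; F \<subseteq> W\<rbrakk> \<Longrightarrow> proper_map (subtopology T F) quotient coset"
    using local_proper_map by blast
  have cont: "continuous_map T quotient coset"
    using quotient_map_coset by (rule quotient_imp_continuous_map)
  define P where "P = W \<inter> {x \<in> topspace T. coset x \<in> N}"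
  have P: "openin T P" "zero \<in> P"
    using W N openin_continuous_map_preimage[OF cont N(1)] by (auto simp: P_def)
  then have "closedin T (topspace T - P)" "zero \<in> topspace T - (topspace T - P)"
    by auto
  moreover have "regular_space T"
    using completely_regular completely_regular_imp_regular_space by blast
  ultimately obtain U0 where U0: "openin T U0" "zero \<in> U0"
      "disjnt (topspace T - P) (T closure_of U0)"
    unfolding regular_space by meson
  then have cl: "T closure_of U0 \<subseteq> P"
    using closure_of_subset_topspace[of T U0] by (auto simp: disjnt_iff)
  have hom: "homeomorphic_map T T (op (inv g))" "homeomorphic_map T T (op g)"
    using g homeomorphic_map_left_translation by auto
  define U where "U = op g ` U0"
  have U0G: "U0 \<subseteq> topspace T"
    using U0 openin_subset by blast
  have closure_U: "T closure_of U = op g ` (T closure_of U0)"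
    unfolding U_def by (rule homeomorphic_map_closure_of[OF hom(2) U0G])
  have image: "op (inv g) ` (T closure_of U) = T closure_of U0"
    unfolding closure_U image_image using g closure_of_subset_topspace[of T U0] by force
  have "homeomorphic_map (subtopology T (T closure_of U)) (subtopology T (T closure_of U0)) (op (inv g))"
    by (rule homeomorphic_map_subtopologies[OF hom(1)])
       (use image in \<open>simp add: Int_absorb1 closure_of_subset_topspace\<close>)
  then have "proper_map (subtopology T (T closure_of U)) quotient (coset \<circ> op (inv g))"
    using W(3)[of "T closure_of U0"] cl
    by (intro proper_map_compose[OF homeomorphic_imp_proper_map]) (auto simp: P_def)
  moreover have "openin T U"
    unfolding U_def by (rule openin_left_translation[OF g U0(1)])
  moreover have "g \<in> U"
    unfolding U_def using U0(2) g by (force intro: image_eqI[of _ _ zero])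
  moreover have "continuous_map T quotient (coset \<circ> op (inv g))"
    using continuous_map_compose[OF homeomorphic_imp_continuous_map[OF hom(1)] cont] .
  moreover have "open_map T quotient (coset \<circ> op (inv g))"
    using open_map_compose[OF homeomorphic_imp_open_map[OF hom(1)] open_map_coset] .
  moreover have "(coset \<circ> op (inv g)) ` (T closure_of U) \<subseteq> N"
    unfolding image_comp[symmetric] image using cl by (auto simp: P_def)
  ultimately show thesis
    using that by blast
qed

text \<open>In the applications \<open>P\<close> and \<open>P'\<close> are one polymorphic property
  at the types of cosets and of points. Openness of \<open>f\<close> and \<open>U\<close> is passed
  on for the sake of pseudocompactness.\<close>

lemma locally_has_lift:
  assumes P: "\<And>f N U. \<lbrakk>openin T U; openin quotient N; continuous_map T quotient f; open_map T quotient f;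
      f ` (T closure_of U) \<subseteq> N; proper_map (subtopology T (T closure_of U)) quotient f;
      P (subtopology quotient (quotient closure_of N))\<rbrakk>
      \<Longrightarrow> P' (subtopology T (T closure_of U))"
    and loc: "locally_has P quotient"
  shows "locally_has P' T"
  unfolding locally_has_def
proof
  fix g assume g: "g \<in> topspace T"
  have "coset zero \<in> topspace quotient"
    by (simp add: topspace_quotient)
  then obtain N where N: "openin quotient N" "coset zero \<in> N"
      "P (subtopology quotient (quotient closure_of N))"
    using loc unfolding locally_has_def by blast
  obtain U p where U: "openin T U" "g \<in> U" "continuous_map T quotient p" "open_map T quotient p"
      "p ` (T closure_of U) \<subseteq> N" "proper_map (subtopology T (T closure_of U)) quotient p"
    by (rule local_structure[OF N(1,2) g])
  have "P' (subtopology T (T closure_of U))"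
    by (rule P[OF U(1) N(1) U(3-6) N(3)])
  then show "\<exists>U. openin T U \<and> g \<in> U \<and> P' (subtopology T (T closure_of U))"
    using U by blast
qed

text \<open>The map \<open>f\<close> sends the closure of \<open>U\<close> into the closure of
  \<open>N\<close> and stays proper with this smaller target, so inheritance by preimages under
  proper maps applies.\<close>

lemma locally_has_lift_proper:
  assumes P: "\<And>(X :: 'a topology) (Y :: 'a set topology) f. \<lbrakk>Tychonoff_space X; proper_map X Y f; continuous_map X Y f; P Y\<rbrakk>
      \<Longrightarrow> P' X"
    and loc: "locally_has P quotient"
  shows "locally_has P' T"
proof (rule locally_has_lift[OF _ loc])
  fix f N U
  assume N: "openin quotient N" and f: "continuous_map T quotient f"
    and fN: "f ` (T closure_of U) \<subseteq> N" and proper: "proper_map (subtopology T (T closure_of U)) quotient f"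
    and PN: "P (subtopology quotient (quotient closure_of N))"
  have "N \<subseteq> quotient closure_of N"
    using N by (simp add: closure_of_subset openin_subset)
  then have f_into: "f \<in> topspace (subtopology T (T closure_of U)) \<rightarrow> quotient closure_of N"
    using fN by auto
  show "P' (subtopology T (T closure_of U))"
  proof (rule P[OF _ _ _ PN])
    show "Tychonoff_space (subtopology T (T closure_of U))"
      using Tychonoff
      by (simp add: Tychonoff_space_def completely_regular_space_subtopology Hausdorff_space_subtopology)
    show "proper_map (subtopology T (T closure_of U)) (subtopology quotient (quotient closure_of N)) f"
      by (rule proper_map_into_subtopology[OF proper f_into])
    show "continuous_map (subtopology T (T closure_of U)) (subtopology quotient (quotient closure_of N)) f"
      by (rule continuous_map_into_subtopology[OF continuous_map_from_subtopology[OF f] f_into])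
  qed
qed

lemma locally_pseudocompact_lift:
  assumes "locally_has pseudocompact_space quotient"
  shows "locally_has pseudocompact_space T"
proof (rule locally_has_lift[OF _ assms])
  fix f N U
  assume U: "openin T U" and N: "openin quotient N" and f: "open_map T quotient f"
    and fN: "f ` (T closure_of U) \<subseteq> N"
    and *: "proper_map (subtopology T (T closure_of U)) quotient f"
      "pseudocompact_space (subtopology quotient (quotient closure_of N))"
  have "f ` U \<subseteq> N"
    using fN closure_of_subset[OF openin_subset[OF U]] by blast
  then show "pseudocompact_space (subtopology T (T closure_of U))"
    using pseudocompact_space_closure_open_proper_map[OF Tychonoff U N f _ *] by blast
qed

end

theorem corollary4p7:
  fixes T :: "'a topology"
    and op :: "'a \<Rightarrow> 'a \<Rightarrow> 'a"
    and gyr :: "'a \<Rightarrow> 'a \<Rightarrow> 'a \<Rightarrow> 'a"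
    and H :: "'a set"
  assumes "strongly_topological_gyrogroup T op gyr"
    and "strong_subgyrogroup (topspace T) op gyr H"
    and "locally_has compact_space (subtopology T H)"
  shows "(locally_has compact_space (gyro_quotient T op H) \<longrightarrow> locally_has compact_space T) \<and>
    (locally_has countably_compact_space (gyro_quotient T op H) \<longrightarrow> locally_has countably_compact_space T) \<and>
    (locally_has pseudocompact_space (gyro_quotient T op H) \<longrightarrow> locally_has pseudocompact_space T) \<and>
    (locally_has sigma_compact_space (gyro_quotient T op H) \<longrightarrow> locally_has sigma_compact_space T) \<and>
    (locally_has Lindelof_space (gyro_quotient T op H) \<longrightarrow> locally_has Lindelof_space T) \<and>
    (locally_has Cech_complete_space (gyro_quotient T op H) \<longrightarrow> locally_has Cech_complete_space T) \<and>
    (locally_has realcompact_space (gyro_quotient T op H) \<longrightarrow> locally_has realcompact_space T)"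
proof -
  interpret strongly_topological_gyrogroup T op gyr
    by (rule assms)
  interpret gyrogroup_quotient T op gyr H
    by unfold_locales (fact assms)+
  show ?thesis
  proof (intro conjI impI)
    show "locally_has compact_space T" if "locally_has compact_space quotient"
      using compact_space_proper_map by (rule locally_has_lift_proper[OF _ that])
    show "locally_has countably_compact_space T" if "locally_has countably_compact_space quotient"
      using countably_compact_space_proper_map by (rule locally_has_lift_proper[OF _ that])
    show "locally_has pseudocompact_space T" if "locally_has pseudocompact_space quotient"
      using that by (rule locally_pseudocompact_lift)
    show "locally_has sigma_compact_space T" if "locally_has sigma_compact_space quotient"
      using sigma_compact_space_proper_map by (rule locally_has_lift_proper[OF _ that])
    show "locally_has Lindelof_space T" if "locally_has Lindelof_space quotient"
      using Lindelof_space_proper_map_preimage by (rule locally_has_lift_proper[OF _ that])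
    show "locally_has Cech_complete_space T" if "locally_has Cech_complete_space quotient"
      using Cech_complete_space_proper_map by (rule locally_has_lift_proper[OF _ that])
    show "locally_has realcompact_space T" if "locally_has realcompact_space quotient"
      using realcompact_space_proper_map by (rule locally_has_lift_proper[OF _ that])
  qed
qed

end
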